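(* Let $G$ be an edge-critical uniquely $3$-colorable planar graph with $|V(G)|\geq 6$. Then $|E(G)|\leq \frac{5}{2}|V(G)|-6$.
   Context: All graphs are finite, undirected and simple. A $k$-coloring of $G$ is an assignment of $k$ colors to $V(G)$ such that adjacent vertices receive different colors; two $k$-colorings are distinct if they produce distinct partitions of $V(G)$ into color classes. A graph $G$ is uniquely $k$-colorable if its chromatic number is $k$ and $G$ has only one $k$-coloring up to permutation of the colors. A uniquely $k$-colorable graph $G$ is edge-critical if $G-e$ is not uniquely $k$-colorable for any edge $e\in E(G)$. *)

theory Defs
  imports "HOL-Analysis.Analysis"
begin

text \<open>A finite simple undirected graph is a pair of a vertex set \<open>V\<close> and a set \<open>E\<close> of edges,
  each edge being the two-element set of its end vertices.\<close>

locale simple_graph =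
  fixes V :: "'a set" and E :: "'a set set"
  assumes finite_verts: "finite V"
    and edge_subset: "e \<in> E \<Longrightarrow> e \<subseteq> V"
    and edge_card: "e \<in> E \<Longrightarrow> card e = 2"

definition is_coloring :: "nat \<Rightarrow> 'a set \<Rightarrow> 'a set set \<Rightarrow> ('a \<Rightarrow> nat) \<Rightarrow> bool" where
  "is_coloring k V E c \<longleftrightarrow>
     (\<forall>v\<in>V. c v < k) \<and> (\<forall>u\<in>V. \<forall>v\<in>V. {u, v} \<in> E \<longrightarrow> c u \<noteq> c v)"

definition color_classes :: "'a set \<Rightarrow> ('a \<Rightarrow> nat) \<Rightarrow> 'a set set" where
  "color_classes V c = (\<lambda>i. {v \<in> V. c v = i}) ` (c ` V)"

definition chromatic_number :: "'a set \<Rightarrow> 'a set set \<Rightarrow> nat" where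
  "chromatic_number V E = (LEAST k. \<exists>c. is_coloring k V E c)"

text \<open>Two colorings are the same up to permutation of the colors iff they induce the same
  partition into color classes.  Existence of a \<open>k\<close>-coloring is implied by the condition on the
  chromatic number, since a finite simple graph has some proper coloring.\<close>

definition uniquely_colorable :: "nat \<Rightarrow> 'a set \<Rightarrow> 'a set set \<Rightarrow> bool" where
  "uniquely_colorable k V E \<longleftrightarrow>
     chromatic_number V E = k \<and>
     (\<forall>c c'. is_coloring k V E c \<longrightarrow> is_coloring k V E c' \<longrightarrow>
        color_classes V c = color_classes V c')"

definition edge_critical_uniquely_colorable :: "nat \<Rightarrow> 'a set \<Rightarrow> 'a set set \<Rightarrow> bool" where
  "edge_critical_uniquely_colorable k V E \<longleftrightarrow>
     uniquely_colorable k V E \<and> (\<forall>e\<in>E. \<not> uniquely_colorable k V (E - {e}))"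

text \<open>A plane drawing, with the complex plane as the plane: vertices are distinct points
  \<open>p v\<close>, every edge \<open>e\<close> is a simple arc \<open>\<gamma> e\<close> joining its end vertices and passing through no
  other vertex, and two distinct edges meet only in common end vertices.\<close>

definition plane_drawing ::
  "'a set \<Rightarrow> 'a set set \<Rightarrow> ('a \<Rightarrow> complex) \<Rightarrow> ('a set \<Rightarrow> real \<Rightarrow> complex) \<Rightarrow> bool" where
  "plane_drawing V E p \<gamma> \<longleftrightarrow>
     inj_on p V \<and>
     (\<forall>e\<in>E. arc (\<gamma> e) \<and> {pathstart (\<gamma> e), pathfinish (\<gamma> e)} = p ` e \<and>
        path_image (\<gamma> e) \<inter> p ` V = p ` e) \<and>
     (\<forall>e\<in>E. \<forall>f\<in>E. e \<noteq> f \<longrightarrow> path_image (\<gamma> e) \<inter> path_image (\<gamma> f) = p ` (e \<inter> f))"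

definition planar :: "'a set \<Rightarrow> 'a set set \<Rightarrow> bool" where
  "planar V E \<longleftrightarrow> (\<exists>p \<gamma>. plane_drawing V E p \<gamma>)"

end

theory Submission
  imports Defs
begin

text \<open>View the 3-colouring as a map \<open>x\<close> from \<open>V\<close> to the field with three elements.  Three elements of
  that field are pairwise distinct or all equal iff they sum to zero, so a colouring satisfies the linear
  equation \<open>z a + z b + z c = 0\<close> for each triangle \<open>abc\<close>, while an edge \<open>uv\<close> corresponds to the functional
  \<open>\<phi>\<close> that sends \<open>z\<close> to \<open>\<plusminus> (z u - z v)\<close>, with the sign chosen such that all edges take the same value
  at \<open>x\<close>.  By edge-criticality some colouring of the graph without \<open>e\<close> is constant on \<open>e\<close>, so \<open>\<phi> e\<close> is not
  congruent to another \<open>\<phi> f\<close> modulo the triangles that avoid \<open>e\<close>.  Consequently the \<open>t\<close> triangle equations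
  are linearly independent, and two edges have congruent functionals only if they lie in a common
  chain of triangles glued along edges; such a chain of \<open>k\<close> triangles has \<open>2k + 1\<close> edges.  Hence
  \<open>|E| = 2t + q\<close> where the \<open>q\<close> classes of functionals satisfy \<open>q 3^t \<le> 3^(n - 2)\<close>, which settles the case
  \<open>t \<ge> n - 3\<close>.  Otherwise \<open>t \<le> n - 4\<close>, and the Euler-type inequality \<open>2|E| + 8 \<le> 4n + t\<close> for plane graphs
  suffices.  That inequality is proved by splitting the disc bounded by a cycle along paths, using the
  theta-curve theorem; inversion of the plane exchanges the two sides of a cycle.\<close>

section \<open>Paths, cycles and triangles\<close>

text \<open>Criticality enters through test vectors: a colouring \<open>z\<close> that merges the
  ends of \<open>e\<close> and respects all other edges kills \<open>\<phi> e\<close> and the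
  equations of all triangles that avoid \<open>e\<close>, but no other \<open>\<phi> f\<close>. The
  exponent \<open>n - 2\<close> reflects two linear conditions shared by all functionals under
  comparison, their values at the constant vector and at \<open>x\<close>. The inequality
  \<open>2|E| + 8 \<le> 4n + t\<close> is what Euler's formula suggests when every face that is not
  a triangle has length at least 4. Counting triangles of the graph instead of triangular faces
  keeps faces out of the proof altogether. The constant 8 is too large for an induction that
  descends to a single vertex, which permits only 4; it is gained at the end by cutting the plane
  along a cycle into two discs. Were that cycle a triangle, it would be counted on both sides and
  the constant would drop to 7, too weak for the theorem. Hence a cycle of length at least 4 is
  needed, and Kempe chains supply one.\<close>

inductive edge_path :: "'a set set \<Rightarrow> 'a \<Rightarrow> 'a \<Rightarrow> bool" where
  edge: "a \<noteq> b \<Longrightarrow> edge_path {{a, b}} a b"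
| step: "edge_path P b c \<Longrightarrow> a \<notin> \<Union>P \<Longrightarrow> edge_path (insert {a, b} P) a c"

lemma edge_path_ends:
  assumes "edge_path P a b"
  shows "a \<noteq> b" "a \<in> \<Union>P" "b \<in> \<Union>P"
  using assms by (induction rule: edge_path.induct) auto

lemma edge_path_card_edge:
  assumes "edge_path P a b" "e \<in> P"
  shows "card e = 2"
  using assms
proof (induction rule: edge_path.induct)
  case (step P b c a)
  then show ?case using edge_path_ends(2)[OF step.hyps(1)] by (auto simp: card_2_iff)
qed (auto simp: card_2_iff)

lemma edge_path_finite:
  assumes "edge_path P a b"
  shows "finite P" "finite (\<Union>P)"
  using assms by (induction rule: edge_path.induct) auto

lemma edge_path_card: "edge_path P a b \<Longrightarrow> card (\<Union>P) = card P + 1"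
proof (induction rule: edge_path.induct)
  case (step P b c a)
  have "\<Union>(insert {a, b} P) = insert a (\<Union>P)"
    using edge_path_ends(2)[OF step.hyps(1)] by auto
  moreover have "{a, b} \<notin> P" using step.hyps(2) by auto
  ultimately show ?case
    using step edge_path_finite[OF step.hyps(1)] by simp
qed simp

lemma edge_path_join:
  assumes "edge_path P a b" "edge_path Q b c" "\<Union>P \<inter> \<Union>Q = {b}"
  shows "edge_path (P \<union> Q) a c"
  using assms
proof (induction rule: edge_path.induct)
  case (edge a b)
  then show ?case using edge_path.step[of Q b c a] by auto
next
  case (step P b d a)
  have "\<Union>P \<inter> \<Union>Q = {d}"
    using step.prems step.hyps edge_path_ends(3)[OF step.hyps(1)] by auto
  moreover have "a \<notin> \<Union>Q"
    using step.prems step.hyps edge_path_ends(3)[OF step.hyps(1)] by auto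
  ultimately show ?case
    using edge_path.step[of "P \<union> Q" b c a] step by auto
qed

lemma edge_path_snoc:
  assumes "edge_path P a b" "c \<notin> \<Union>P"
  shows "edge_path (insert {b, c} P) a c"
proof -
  have "b \<noteq> c" using assms(2) edge_path_ends(3)[OF assms(1)] by auto
  moreover have "\<Union>P \<inter> \<Union>{{b, c}} = {b}"
    using assms edge_path_ends(3)[OF assms(1)] by auto
  ultimately show ?thesis
    using edge_path_join[OF assms(1) edge_path.edge[of b c]] by simp
qed

lemma edge_path_sym: "edge_path P a b \<Longrightarrow> edge_path P b a"
proof (induction rule: edge_path.induct)
  case (edge a b)
  then show ?case using edge_path.edge[of b a] by (simp add: insert_commute)
next
  case (step P b c a)
  then show ?case using edge_path_snoc[of P c b a] by (simp add: insert_commute)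
qed

lemma edge_path_split:
  assumes "edge_path P a b" "v \<in> \<Union>P" "v \<noteq> a" "v \<noteq> b"
  obtains P1 P2 where "P = P1 \<union> P2" "edge_path P1 a v" "edge_path P2 v b" "\<Union>P1 \<inter> \<Union>P2 = {v}"
proof -
  have "\<exists>P1 P2. P = P1 \<union> P2 \<and> edge_path P1 a v \<and> edge_path P2 v b \<and> \<Union>P1 \<inter> \<Union>P2 = {v}"
    using assms
  proof (induction rule: edge_path.induct)
    case (step P b c a)
    show ?case
    proof (cases "v = b")
      case True
      have "edge_path {{a, b}} a b"
        using step.hyps edge_path_ends(2)[OF step.hyps(1)] by (auto intro: edge_path.edge)
      moreover have "\<Union>{{a, b}} \<inter> \<Union>P = {b}"
        using step.hyps(2) edge_path_ends(2)[OF step.hyps(1)] by auto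
      ultimately have "insert {a, b} P = {{a, b}} \<union> P \<and> edge_path {{a, b}} a v \<and>
          edge_path P v c \<and> \<Union>{{a, b}} \<inter> \<Union>P = {v}"
        using True step.hyps(1) by simp
      then show ?thesis by blast
    next
      case False
      have "v \<in> \<Union>P" using step.prems False by auto
      then obtain P1 P2 where *: "P = P1 \<union> P2" "edge_path P1 b v" "edge_path P2 v c"
          "\<Union>P1 \<inter> \<Union>P2 = {v}"
        using step.IH[OF _ False step.prems(3)] by blast
      have "b \<notin> \<Union>P2" using * False edge_path_ends(2)[OF *(2)] by auto
      moreover have "a \<notin> \<Union>P1" "a \<notin> \<Union>P2" using * step.hyps(2) by auto
      ultimately have "\<Union>(insert {a, b} P1) \<inter> \<Union>P2 = {v}" using *(4) by auto
      moreover have "edge_path (insert {a, b} P1) a v"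
        using edge_path.step[OF *(2) \<open>a \<notin> \<Union>P1\<close>] .
      moreover have "insert {a, b} P = insert {a, b} P1 \<union> P2" using *(1) by simp
      ultimately show ?thesis using *(3) by blast
    qed
  qed auto
  then show thesis using that by blast
qed

text \<open>Avoids walks: if the new vertex already lies on the path, the path is cut off there.
  This makes reachability by paths closed under edges.\<close>

lemma edge_path_extend:
  assumes "edge_path P a v" "w \<noteq> a" "w \<noteq> v"
  obtains Q where "Q \<subseteq> insert {v, w} P" "edge_path Q a w"
proof (cases "w \<in> \<Union>P")
  case True
  then show thesis using edge_path_split[OF assms(1) True] assms that by (metis Un_upper1 subset_insertI2)
next
  case False
  then show thesis using edge_path_snoc[OF assms(1)] that by blast
qed

definition triangles :: "'a set set \<Rightarrow> 'a set set" where
  "triangles E = {T. card T = 3 \<and> (\<forall>u\<in>T. \<forall>v\<in>T. u \<noteq> v \<longrightarrow> {u, v} \<in> E)}"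

lemma triangle_edge: "T \<in> triangles E \<Longrightarrow> u \<in> T \<Longrightarrow> v \<in> T \<Longrightarrow> u \<noteq> v \<Longrightarrow> {u, v} \<in> E"
  unfolding triangles_def by blast

lemma triangle_transfer:
  assumes "T \<in> triangles E" "\<And>u v. u \<in> T \<Longrightarrow> v \<in> T \<Longrightarrow> u \<noteq> v \<Longrightarrow> {u, v} \<in> F"
  shows "T \<in> triangles F"
  using assms unfolding triangles_def by blast

lemma triangles_mono: "E \<subseteq> F \<Longrightarrow> triangles E \<subseteq> triangles F"
  by (auto simp: triangles_def)

lemma triangles_Int: "triangles E \<inter> triangles F = triangles (E \<inter> F)"
  by (auto simp: triangles_def)

lemma triangle_obtain:
  assumes "T \<in> triangles E"
  obtains a b c where "T = {a, b, c}" "a \<noteq> b" "b \<noteq> c" "a \<noteq> c"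
    "{a, b} \<in> E" "{b, c} \<in> E" "{a, c} \<in> E"
proof -
  obtain a b c where "T = {a, b, c}" "a \<noteq> b" "b \<noteq> c" "a \<noteq> c"
    using assms by (auto simp: triangles_def card_3_iff)
  then show thesis using assms by (intro that[of a b c]) (auto simp: triangles_def)
qed

lemma triangle_subset:
  assumes "T \<in> triangles E"
  shows "T \<subseteq> \<Union>E"
  using triangle_obtain[OF assms] by blast

lemma finite_triangles:
  assumes "finite (\<Union>E)"
  shows "finite (triangles E)"
proof -
  have "triangles E \<subseteq> Pow (\<Union>E)" using triangle_subset by blast
  then show ?thesis using assms by (meson finite_Pow_iff finite_subset)
qed

text \<open>The prepended vertex \<open>a\<close> is incident with \<open>{a, b}\<close> only, so a
  triangle through it would have to fit into two vertices.\<close>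

lemma edge_path_no_triangle: "edge_path P a b \<Longrightarrow> triangles P = {}"
proof (induction rule: edge_path.induct)
  case (edge a b)
  have no: "T \<notin> triangles {{a, b}}" for T
  proof
    assume T: "T \<in> triangles {{a, b}}"
    have "T \<subseteq> {a, b}" using triangle_subset[OF T] by simp
    then have "card T \<le> card {a, b}" by (intro card_mono) auto
    then show False using T edge by (simp add: triangles_def)
  qed
  then show ?case by (simp add: set_eq_iff)
next
  case (step P b c a)
  have "T \<notin> triangles (insert {a, b} P)" for T
  proof
    assume T: "T \<in> triangles (insert {a, b} P)"
    show False
    proof (cases "a \<in> T")
      case False
      have "T \<in> triangles P"
      proof (rule triangle_transfer[OF T])
        fix u v assume uv: "u \<in> T" "v \<in> T" "u \<noteq> v"
        have "{u, v} \<noteq> {a, b}" using uv False by (auto simp: doubleton_eq_iff)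
        then show "{u, v} \<in> P" using triangle_edge[OF T uv] by blast
      qed
      then show False using step.IH by simp
    next
      case True
      have "T \<subseteq> {a, b}"
      proof
        fix u assume u: "u \<in> T"
        show "u \<in> {a, b}"
        proof (cases "u = a")
          case False
          then have "{a, u} \<in> insert {a, b} P" using triangle_edge[OF T True u] by simp
          moreover have "{a, u} \<notin> P" using step.hyps(2) by blast
          ultimately show ?thesis by blast
        qed auto
      qed
      then have "card T \<le> card {a, b}" by (intro card_mono) auto
      also have "\<dots> \<le> 2" by (simp add: card_insert_if)
      finally show False using T by (simp add: triangles_def)
    qed
  qed
  then show ?case by (simp add: set_eq_iff)
qed

text \<open>A cycle is recorded together with a decomposition into two paths between chosen vertices.\<close>

definition cycle_at :: "'a set set \<Rightarrow> 'a set set \<Rightarrow> 'a \<Rightarrow> 'a \<Rightarrow> bool" where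
  "cycle_at P Q a b \<longleftrightarrow> edge_path P a b \<and> edge_path Q a b \<and> \<Union>P \<inter> \<Union>Q = {a, b} \<and> P \<inter> Q = {}"

definition cycle :: "'a set set \<Rightarrow> bool" where
  "cycle C \<longleftrightarrow> (\<exists>P Q a b. cycle_at P Q a b \<and> C = P \<union> Q)"

lemma cycle_at_commute: "cycle_at P Q a b \<Longrightarrow> cycle_at Q P a b"
  by (auto simp: cycle_at_def)

lemma cycle_at_sym: "cycle_at P Q a b \<Longrightarrow> cycle_at P Q b a"
  by (auto simp: cycle_at_def edge_path_sym)

text \<open>When \<open>v\<close> cuts \<open>P\<close> into \<open>P1\<close> from \<open>a\<close>
  to \<open>v\<close> and \<open>P2\<close> from \<open>v\<close> to \<open>b\<close>, the same
  cycle consists of \<open>P2\<close> and of the way round through \<open>P1\<close> and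
  \<open>Q\<close>.\<close>

lemma cycle_at_move_aux:
  assumes "cycle_at P Q a b" "v \<in> \<Union>P" "v \<noteq> a" "v \<noteq> b"
  shows "\<exists>P' Q'. cycle_at P' Q' v b \<and> P' \<union> Q' = P \<union> Q"
proof -
  have P: "edge_path P a b" and Q: "edge_path Q a b" and PQ: "\<Union>P \<inter> \<Union>Q = {a, b}" "P \<inter> Q = {}"
    using assms by (auto simp: cycle_at_def)
  obtain P1 P2 where *: "P = P1 \<union> P2" "edge_path P1 a v" "edge_path P2 v b" "\<Union>P1 \<inter> \<Union>P2 = {v}"
    using edge_path_split[OF P assms(2-4)] by blast
  have ab: "a \<notin> \<Union>P2" "b \<notin> \<Union>P1" "v \<notin> \<Union>Q"
    using * assms(2-4) PQ edge_path_ends(2)[OF *(2)] edge_path_ends(3)[OF *(3)] by auto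
  have 1: "\<Union>P1 \<inter> \<Union>Q = {a}" using PQ * ab edge_path_ends(2)[OF *(2)] edge_path_ends(2)[OF Q] by auto
  have 2: "edge_path (P1 \<union> Q) v b" using edge_path_join[OF edge_path_sym[OF *(2)] Q 1] .
  have 3: "P2 \<inter> P1 = {}"
  proof -
    have "False" if "e \<in> P2" "e \<in> P1" for e
    proof -
      have "e \<subseteq> {v}" using that *(4) by blast
      then have "card e \<le> card {v}" by (intro card_mono) auto
      then show False using edge_path_card_edge[OF *(2) that(2)] by simp
    qed
    then show ?thesis by blast
  qed
  have "\<Union>P2 \<inter> \<Union>Q = {b}"
    using PQ * ab edge_path_ends(3)[OF *(3)] edge_path_ends(3)[OF Q] by auto
  then have "\<Union>P2 \<inter> \<Union>(P1 \<union> Q) = {v, b}" using *(4) by auto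
  then have "cycle_at P2 (P1 \<union> Q) v b"
    using *(1,3) 2 3 PQ by (auto simp: cycle_at_def)
  then show ?thesis using *(1) by (intro exI[of _ P2] exI[of _ "P1 \<union> Q"]) auto
qed

lemma cycle_at_move:
  assumes "cycle_at P Q a b" "v \<in> \<Union>(P \<union> Q)" "v \<noteq> b"
  obtains P' Q' where "cycle_at P' Q' v b" "P' \<union> Q' = P \<union> Q"
proof (cases "v = a")
  case False
  consider "v \<in> \<Union>P" | "v \<in> \<Union>Q" using assms(2) by auto
  then show thesis
  proof cases
    case 1
    then show thesis using cycle_at_move_aux[OF assms(1) 1 False assms(3)] that by blast
  next
    case 2
    then show thesis
      using cycle_at_move_aux[OF cycle_at_commute[OF assms(1)] 2 False assms(3)] that by (metis Un_commute)
  qed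
qed (use assms that in auto)

text \<open>One end is moved to \<open>a\<close>, then, with the roles of the ends exchanged, the
  other to \<open>b\<close>. So nothing depends on the decomposition by which a set was recognised
  as a cycle.\<close>

lemma cycle_split:
  assumes "cycle C" "a \<in> \<Union>C" "b \<in> \<Union>C" "a \<noteq> b"
  obtains P Q where "cycle_at P Q a b" "C = P \<union> Q"
proof -
  obtain P Q c d where PQ: "cycle_at P Q c d" "C = P \<union> Q" using assms(1) by (auto simp: cycle_def)
  have "\<exists>P Q d. cycle_at P Q a d \<and> C = P \<union> Q"
  proof (cases "a = d")
    case True
    then show ?thesis using PQ cycle_at_sym by metis
  next
    case False
    then show ?thesis using cycle_at_move[OF PQ(1)] PQ(2) assms(2) by metis
  qed
  then obtain P Q d where PQ: "cycle_at P Q a d" "C = P \<union> Q" by blast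
  then show thesis
    using cycle_at_move[OF cycle_at_sym[OF PQ(1)], of b] assms(3,4) that cycle_at_sym by metis
qed

lemma cycle_finite:
  assumes "cycle C"
  shows "finite C" "finite (\<Union>C)"
proof -
  obtain P Q a b where PQ: "edge_path P a b" "edge_path Q a b" "C = P \<union> Q"
    using assms unfolding cycle_def cycle_at_def by blast
  show "finite C" "finite (\<Union>C)"
    using edge_path_finite[OF PQ(1)] edge_path_finite[OF PQ(2)] PQ(3) by auto
qed

lemma cycle_card:
  assumes "cycle C"
  shows "card (\<Union>C) = card C"
proof -
  obtain P Q a b where PQ: "cycle_at P Q a b" "C = P \<union> Q" using assms by (auto simp: cycle_def)
  then have P: "edge_path P a b" "edge_path Q a b" "\<Union>P \<inter> \<Union>Q = {a, b}" "P \<inter> Q = {}"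
    by (auto simp: cycle_at_def)
  note fin = edge_path_finite[OF P(1)] edge_path_finite[OF P(2)]
  have "card (\<Union>P) + card (\<Union>Q) = card (\<Union>C) + card {a, b}"
    using card_Un_Int[of "\<Union>P" "\<Union>Q"] fin P(3) PQ(2) by (simp add: Un_commute)
  moreover have "card C = card P + card Q" using PQ P fin by (simp add: card_Un_disjoint)
  ultimately show ?thesis
    using edge_path_card[OF P(1)] edge_path_card[OF P(2)] edge_path_ends(1)[OF P(1)] by simp
qed

lemma edge_path_nonempty: "edge_path P a b \<Longrightarrow> P \<noteq> {}"
  by (induction rule: edge_path.induct) auto

lemma edge_path_card_1:
  assumes "edge_path P a b" "card P = 1"
  shows "P = {{a, b}}"
proof -
  obtain e where e: "P = {e}" using assms(2) card_1_singletonE by blast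
  have "card e = 2" "a \<in> e" "b \<in> e" "a \<noteq> b"
    using edge_path_card_edge[OF assms(1)] edge_path_ends[OF assms(1)] e by auto
  then show ?thesis using e by (auto simp: card_2_iff)
qed

text \<open>Disjointness of the two edge sets is decisive: two paths of one edge each would both be
  \<open>{{a, b}}\<close>.\<close>

lemma cycle_card_ge_3:
  assumes "cycle C"
  shows "card C \<ge> 3"
proof -
  obtain P Q a b where PQ: "cycle_at P Q a b" "C = P \<union> Q" using assms by (auto simp: cycle_def)
  then have P: "edge_path P a b" "edge_path Q a b" "P \<inter> Q = {}"
    by (auto simp: cycle_at_def)
  have fin: "finite P" "finite Q"
    using edge_path_finite(1)[OF P(1)] edge_path_finite(1)[OF P(2)] .
  then have "card P \<noteq> 0" "card Q \<noteq> 0"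
    using edge_path_nonempty[OF P(1)] edge_path_nonempty[OF P(2)] by simp_all
  moreover have "\<not> (card P = 1 \<and> card Q = 1)"
    using edge_path_card_1[OF P(1)] edge_path_card_1[OF P(2)] P(3) by blast
  moreover have "card C = card P + card Q" using PQ P fin by (simp add: card_Un_disjoint)
  ultimately show ?thesis by linarith
qed

text \<open>Three vertices have exactly three two-element subsets, so the three edges of the cycle
  exhaust them.\<close>

lemma cycle_card_3:
  assumes "cycle C" "card C = 3"
  shows "\<Union>C \<in> triangles C"
proof -
  obtain P Q a b where PQ: "cycle_at P Q a b" "C = P \<union> Q" using assms by (auto simp: cycle_def)
  have P: "edge_path P a b" "edge_path Q a b" using PQ(1) unfolding cycle_at_def by blast+
  have C2: "card e = 2" if "e \<in> C" for e
    using that PQ(2) edge_path_card_edge[OF P(1)] edge_path_card_edge[OF P(2)] by blast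
  let ?S = "{e. e \<subseteq> \<Union>C \<and> card e = 2}"
  have c3: "card (\<Union>C) = 3" using cycle_card[OF assms(1)] assms(2) by simp
  have fin: "finite (\<Union>C)" using cycle_finite(2)[OF assms(1)] .
  have "card ?S = 3" using n_subsets[OF fin, of 2] c3 by (simp add: numeral_eq_Suc)
  moreover have "finite ?S" using fin by simp
  moreover have "C \<subseteq> ?S" using C2 by blast
  ultimately have "C = ?S" using card_subset_eq[of ?S C] assms(2) by metis
  have "{u, v} \<in> C" if "u \<in> \<Union>C" "v \<in> \<Union>C" "u \<noteq> v" for u v
  proof -
    have "{u, v} \<in> ?S" using that by simp
    then show ?thesis by (rule subsetD[OF equalityD2[OF \<open>C = ?S\<close>]])
  qed
  then show ?thesis using c3 unfolding triangles_def by blast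
qed

text \<open>A triangle in a longer cycle misses a vertex \<open>v\<close> of it. Split the cycle at
  \<open>v\<close> and at a vertex \<open>a\<close> of the triangle. Neither path contains all three
  vertices, since it would then contain the triangle. So there are a vertex \<open>x\<close> off
  \<open>P\<close> and a vertex \<open>y\<close> off \<open>Q\<close>, and the edge between them
  lies in neither path.\<close>

lemma cycle_triangles:
  assumes "cycle C"
  shows "triangles C = (if card C = 3 then {\<Union>C} else {})"
proof -
  note fin = cycle_finite[OF assms]
  have *: "T = \<Union>C \<and> card C = 3" if T: "T \<in> triangles C" for T
  proof (rule ccontr)
    assume neg: "\<not> ?thesis"
    have sub: "T \<subseteq> \<Union>C" using triangle_subset[OF T] .
    have c: "card T = 3" using T by (simp add: triangles_def)
    have "T \<noteq> \<Union>C" using neg c cycle_card[OF assms] by auto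
    then obtain v where v: "v \<in> \<Union>C" "v \<notin> T" using sub by auto
    obtain a where a: "a \<in> T" using c by fastforce
    obtain P Q where PQ: "cycle_at P Q v a" "C = P \<union> Q"
      using cycle_split[OF assms v(1), of a] a sub v by blast
    have P: "edge_path P v a" "edge_path Q v a" "\<Union>P \<inter> \<Union>Q = {v, a}"
      using PQ by (auto simp: cycle_at_def)
    have nP: "\<not> T \<subseteq> \<Union>P"
    proof
      assume "T \<subseteq> \<Union>P"
      have no: "{x, y} \<notin> Q" if "x \<in> T" "y \<in> T" "x \<noteq> y" for x y
      proof
        assume "{x, y} \<in> Q"
        then have "{x, y} \<subseteq> {v, a}" using that \<open>T \<subseteq> \<Union>P\<close> P(3) by blast
        then show False using that v(2) by auto
      qed
      have "T \<in> triangles P"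
      proof (rule triangle_transfer[OF T])
        fix u w assume "u \<in> T" "w \<in> T" "u \<noteq> w"
        then show "{u, w} \<in> P" using triangle_edge[OF T] no PQ(2) by blast
      qed
      then show False using edge_path_no_triangle[OF P(1)] by auto
    qed
    have nQ: "\<not> T \<subseteq> \<Union>Q"
    proof
      assume "T \<subseteq> \<Union>Q"
      have no: "{x, y} \<notin> P" if "x \<in> T" "y \<in> T" "x \<noteq> y" for x y
      proof
        assume "{x, y} \<in> P"
        then have "{x, y} \<subseteq> {v, a}" using that \<open>T \<subseteq> \<Union>Q\<close> P(3) by blast
        then show False using that v(2) by auto
      qed
      have "T \<in> triangles Q"
      proof (rule triangle_transfer[OF T])
        fix u w assume "u \<in> T" "w \<in> T" "u \<noteq> w"
        then show "{u, w} \<in> Q" using triangle_edge[OF T] no PQ(2) by blast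
      qed
      then show False using edge_path_no_triangle[OF P(2)] by auto
    qed
    obtain x where x: "x \<in> T" "x \<notin> \<Union>P" using nP unfolding subset_iff by blast
    obtain y where y: "y \<in> T" "y \<notin> \<Union>Q" using nQ unfolding subset_iff by blast
    note xy = x y
    have "x \<in> \<Union>(P \<union> Q)" using subsetD[OF sub x(1)] unfolding PQ(2) .
    then have "x \<in> \<Union>Q" using x(2) by blast
    then have "x \<noteq> y" using y(2) by blast
    then have "{x, y} \<in> C" using triangle_edge[OF T] xy by blast
    then have "{x, y} \<in> P \<or> {x, y} \<in> Q" using PQ(2) by (simp only: Un_iff)
    then show False
    proof
      assume "{x, y} \<in> P"
      then show False using x(2) by blast
    next
      assume "{x, y} \<in> Q"
      then show False using y(2) by blast
    qed
  qed
  show ?thesis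
  proof (cases "card C = 3")
    case True
    have "triangles C = {\<Union>C}" using * cycle_card_3[OF assms True] by blast
    then show ?thesis using True by simp
  next
    case False
    have "triangles C = {}" using * False by blast
    then show ?thesis using False by simp
  qed
qed

section \<open>Plane drawings\<close>

definition curve :: "('a set \<Rightarrow> real \<Rightarrow> complex) \<Rightarrow> 'a set set \<Rightarrow> complex set" where
  "curve \<gamma> P = (\<Union>e\<in>P. path_image (\<gamma> e))"

definition open_arc :: "('a \<Rightarrow> complex) \<Rightarrow> ('a set \<Rightarrow> real \<Rightarrow> complex) \<Rightarrow> 'a set \<Rightarrow> complex set" where
  "open_arc p \<gamma> e = path_image (\<gamma> e) - p ` e"

lemma curve_Un: "curve \<gamma> (P \<union> Q) = curve \<gamma> P \<union> curve \<gamma> Q"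
  by (auto simp: curve_def)

locale plane_graph = simple_graph V E for V :: "'a set" and E :: "'a set set" +
  fixes p :: "'a \<Rightarrow> complex" and \<gamma> :: "'a set \<Rightarrow> real \<Rightarrow> complex"
  assumes drawing: "plane_drawing V E p \<gamma>"
begin

lemma inj_p: "inj_on p V"
  using drawing by (simp add: plane_drawing_def)

lemma edge_arc:
  assumes "e \<in> E"
  shows "arc (\<gamma> e)" "{pathstart (\<gamma> e), pathfinish (\<gamma> e)} = p ` e"
    "path_image (\<gamma> e) \<inter> p ` V = p ` e"
  using drawing assms by (simp_all add: plane_drawing_def)

lemma edges_Int: "e \<in> E \<Longrightarrow> f \<in> E \<Longrightarrow> e \<noteq> f \<Longrightarrow> path_image (\<gamma> e) \<inter> path_image (\<gamma> f) = p ` (e \<inter> f)"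
  using drawing by (simp add: plane_drawing_def)

lemma edge_image_subset: "e \<in> E \<Longrightarrow> p ` e \<subseteq> path_image (\<gamma> e)"
  using edge_arc(3) by blast

lemma finite_edges: "finite E"
proof -
  have "E \<subseteq> Pow V" using edge_subset by blast
  then show ?thesis using finite_verts by (meson finite_Pow_iff finite_subset)
qed

lemma Union_edges: "P \<subseteq> E \<Longrightarrow> \<Union>P \<subseteq> V"
  using edge_subset by blast

lemma open_arc_connected:
  assumes "e \<in> E"
  shows "connected (open_arc p \<gamma> e)" "open_arc p \<gamma> e \<noteq> {}"
  using connected_simple_path_endless[OF arc_imp_simple_path[OF edge_arc(1)[OF assms]]]
    nonempty_simple_path_endless[OF arc_imp_simple_path[OF edge_arc(1)[OF assms]]]
  by (simp_all add: edge_arc(2)[OF assms] open_arc_def)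

lemma open_arc_dense:
  assumes "e \<in> E"
  shows "path_image (\<gamma> e) \<subseteq> closure (open_arc p \<gamma> e)"
proof -
  have "open_arc p \<gamma> e = \<gamma> e ` {0<..<1}"
    using simple_path_endless[OF arc_imp_simple_path[OF edge_arc(1)[OF assms]]]
    by (simp add: edge_arc(2)[OF assms] open_arc_def)
  moreover have "continuous_on {0..1} (\<gamma> e)"
    using arc_imp_path[OF edge_arc(1)[OF assms]] by (simp add: path_def)
  then have "\<gamma> e ` closure {0<..<1} \<subseteq> closure (\<gamma> e ` {0<..<1})"
    by (intro image_closure_subset closure_subset) auto
  ultimately show ?thesis by (simp add: path_image_def)
qed

lemma vertex_on_edge:
  assumes "e \<in> E" "v \<in> V" "p v \<in> path_image (\<gamma> e)"
  shows "v \<in> e"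
proof -
  have "p v \<in> p ` e" using edge_arc(3)[OF assms(1)] assms by blast
  then show ?thesis using inj_p edge_subset[OF assms(1)] assms(2) by (meson inj_on_image_mem_iff)
qed

lemma vertex_on_curve:
  assumes "P \<subseteq> E" "v \<in> V"
  shows "p v \<in> curve \<gamma> P \<longleftrightarrow> v \<in> \<Union>P"
proof
  assume "p v \<in> curve \<gamma> P"
  then obtain e where "e \<in> P" "p v \<in> path_image (\<gamma> e)" by (auto simp: curve_def)
  then show "v \<in> \<Union>P" using vertex_on_edge[of e v] assms by blast
next
  assume "v \<in> \<Union>P"
  then obtain e where e: "e \<in> P" "v \<in> e" by blast
  then have "p v \<in> path_image (\<gamma> e)" using edge_image_subset[of e] assms by blast
  then show "p v \<in> curve \<gamma> P" using e by (auto simp: curve_def)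
qed

lemma curve_Int:
  assumes "P \<subseteq> E" "Q \<subseteq> E" "P \<inter> Q = {}"
  shows "curve \<gamma> P \<inter> curve \<gamma> Q = p ` (\<Union>P \<inter> \<Union>Q)"
proof
  show "curve \<gamma> P \<inter> curve \<gamma> Q \<subseteq> p ` (\<Union>P \<inter> \<Union>Q)"
  proof
    fix z assume "z \<in> curve \<gamma> P \<inter> curve \<gamma> Q"
    then obtain e f where ef: "e \<in> P" "f \<in> Q" "z \<in> path_image (\<gamma> e)" "z \<in> path_image (\<gamma> f)"
      unfolding curve_def by blast
    then have "z \<in> p ` (e \<inter> f)" using edges_Int[of e f] assms by blast
    then show "z \<in> p ` (\<Union>P \<inter> \<Union>Q)" using ef by blast
  qed
next
  have "p v \<in> curve \<gamma> P \<inter> curve \<gamma> Q" if "v \<in> \<Union>P" "v \<in> \<Union>Q" for v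
    using that vertex_on_curve[OF assms(1)] vertex_on_curve[OF assms(2)] Union_edges[OF assms(1)] by blast
  then show "p ` (\<Union>P \<inter> \<Union>Q) \<subseteq> curve \<gamma> P \<inter> curve \<gamma> Q" by blast
qed

lemma open_arc_avoids:
  assumes "P \<subseteq> E" "e \<in> E" "e \<notin> P"
  shows "open_arc p \<gamma> e \<inter> curve \<gamma> P = {}"
proof -
  have "path_image (\<gamma> e) \<inter> path_image (\<gamma> f) \<subseteq> p ` e" if "f \<in> P" for f
    using edges_Int[of e f] that assms by blast
  then show ?thesis unfolding open_arc_def curve_def by blast
qed

lemma compact_curve:
  assumes "P \<subseteq> E"
  shows "compact (curve \<gamma> P)"
proof -
  have "finite P" using assms finite_edges finite_subset by blast
  then show ?thesis unfolding curve_def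
    using assms edge_arc(1) compact_arc_image by (intro compact_UN) auto
qed

text \<open>Turns a path of the graph into a single arc, the form in which the theta-curve theorem
  takes its three branches.\<close>

lemma path_arc:
  assumes "edge_path P a b" "P \<subseteq> E"
  shows "\<exists>g. arc g \<and> path_image g = curve \<gamma> P \<and> pathstart g = p a \<and> pathfinish g = p b"
proof -
  have single: "\<exists>g. arc g \<and> path_image g = path_image (\<gamma> {a, b}) \<and> pathstart g = p a \<and> pathfinish g = p b"
    if e: "{a, b} \<in> E" for a b
  proof -
    have "{pathstart (\<gamma> {a, b}), pathfinish (\<gamma> {a, b})} = {p a, p b}"
      using edge_arc(2)[OF e] by simp
    then consider "pathstart (\<gamma> {a, b}) = p a" "pathfinish (\<gamma> {a, b}) = p b"
      | "pathstart (\<gamma> {a, b}) = p b" "pathfinish (\<gamma> {a, b}) = p a"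
      by (auto simp: doubleton_eq_iff)
    then show ?thesis
    proof cases
      case 1
      then show ?thesis using edge_arc(1)[OF e] by blast
    next
      case 2
      then show ?thesis using edge_arc(1)[OF e]
        by (intro exI[of _ "reversepath (\<gamma> {a, b})"]) (simp add: arc_reversepath)
    qed
  qed
  show ?thesis using assms
  proof (induction rule: edge_path.induct)
    case (edge a b)
    then show ?case using single[of a b] by (simp add: curve_def)
  next
    case (step P b c a)
    obtain g where g: "arc g" "path_image g = curve \<gamma> P" "pathstart g = p b" "pathfinish g = p c"
      using step by blast
    obtain h where h: "arc h" "path_image h = path_image (\<gamma> {a, b})" "pathstart h = p a" "pathfinish h = p b"
      using single[of a b] step.prems by blast
    have "{a, b} \<notin> P" using step.hyps(2) by blast
    then have "curve \<gamma> {{a, b}} \<inter> curve \<gamma> P = p ` (\<Union>{{a, b}} \<inter> \<Union>P)"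
      using step.prems by (intro curve_Int) auto
    also have "\<Union>{{a, b}} \<inter> \<Union>P = {b}" using step.hyps(2) edge_path_ends(2)[OF step.hyps(1)] by auto
    finally have "path_image h \<inter> path_image g \<subseteq> {pathstart g}" using g h by (simp add: curve_def)
    then have "arc (h +++ g)" using g h by (intro arc_join) auto
    moreover have "path_image (h +++ g) = curve \<gamma> (insert {a, b} P)"
      using g h by (simp add: path_image_join curve_def)
    ultimately show ?case using g h by (intro exI[of _ "h +++ g"]) simp
  qed
qed

lemma subgraph:
  assumes "V' \<subseteq> V" "E' \<subseteq> E" "\<And>e. e \<in> E' \<Longrightarrow> e \<subseteq> V'"
  shows "plane_graph V' E' p \<gamma>"
proof
  show "finite V'" using assms(1) finite_verts finite_subset by blast
  show "e \<subseteq> V'" "card e = 2" if "e \<in> E'" for e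
    using that assms edge_card by auto
  have "path_image (\<gamma> e) \<inter> p ` V' = p ` e" if "e \<in> E'" for e
  proof -
    have "e \<in> E" using that assms(2) by blast
    then show ?thesis using edge_arc(3)[of e] assms(1) assms(3)[OF that] by blast
  qed
  moreover have "inj_on p V'" using inj_p assms(1) inj_on_subset by blast
  ultimately show "plane_drawing V' E' p \<gamma>"
    using edge_arc(1,2) edges_Int assms(2) unfolding plane_drawing_def by (meson subsetD)
qed

end

section \<open>Discs bounded by a cycle, and ears that split them\<close>

definition bounding_cycle where
  "bounding_cycle V E p \<gamma> C \<longleftrightarrow> C \<subseteq> E \<and> cycle C \<and>
     (\<forall>v\<in>V - \<Union>C. p v \<in> inside (curve \<gamma> C)) \<and>
     (\<forall>e\<in>E - C. open_arc p \<gamma> e \<subseteq> inside (curve \<gamma> C))"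

context plane_graph
begin

text \<open>Stated for any region \<open>I\<close> whose closure adds only points of the curve, so
  that it serves for the inside and for the outside of a cycle. The closure condition places the
  ends of each chosen edge in \<open>V'\<close>, because the open arc of an edge is dense in the
  edge.\<close>

lemma side_part:
  assumes C: "C \<subseteq> E" and I: "closure I \<subseteq> curve \<gamma> C \<union> I"
    and V': "V' = {v \<in> V. v \<in> \<Union>C \<or> p v \<in> I}"
    and E': "E' = C \<union> {e \<in> E - C. open_arc p \<gamma> e \<subseteq> I}"
  shows "plane_graph V' E' p \<gamma>"
proof (rule subgraph)
  show "V' \<subseteq> V" "E' \<subseteq> E" using V' E' C by auto
  fix e assume e: "e \<in> E'"
  show "e \<subseteq> V'"
  proof (cases "e \<in> C")
    case True
    then show ?thesis using V' C Union_edges[OF C] by blast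
  next
    case False
    then have eE: "e \<in> E" and sub: "open_arc p \<gamma> e \<subseteq> I" using e E' by auto
    have "path_image (\<gamma> e) \<subseteq> closure (open_arc p \<gamma> e)" using open_arc_dense[OF eE] .
    also have "\<dots> \<subseteq> closure I" using sub closure_mono by blast
    also have "\<dots> \<subseteq> curve \<gamma> C \<union> I" by (rule I)
    finally have sub2: "path_image (\<gamma> e) \<subseteq> curve \<gamma> C \<union> I" .
    show ?thesis
    proof
      fix v assume v: "v \<in> e"
      then have "v \<in> V" using edge_subset[OF eE] by blast
      have "p v \<in> curve \<gamma> C \<union> I" using sub2 edge_image_subset[OF eE] v by blast
      then show "v \<in> V'" using vertex_on_curve[OF C \<open>v \<in> V\<close>] \<open>v \<in> V\<close> V' by blast
    qed
  qed
qed

lemma closed_curve: "C \<subseteq> E \<Longrightarrow> closed (curve \<gamma> C)"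
  by (rule compact_imp_closed[OF compact_curve])

lemma disc_part:
  assumes C: "C \<subseteq> E" "cycle C"
    and V': "V' = {v \<in> V. v \<in> \<Union>C \<or> p v \<in> inside (curve \<gamma> C)}"
    and E': "E' = C \<union> {e \<in> E - C. open_arc p \<gamma> e \<subseteq> inside (curve \<gamma> C)}"
  shows "plane_graph V' E' p \<gamma>" "bounding_cycle V' E' p \<gamma> C"
proof -
  show "plane_graph V' E' p \<gamma>"
    by (rule side_part[OF C(1) closure_inside_subset[OF closed_curve[OF C(1)]] V' E'])
  show "bounding_cycle V' E' p \<gamma> C"
    using C V' E' unfolding bounding_cycle_def by blast
qed

text \<open>The ear \<open>R\<close> and the two paths of \<open>C\<close> between its ends form a
  theta-curve, so the inside of \<open>C\<close> falls into the insides \<open>?I1\<close> and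
  \<open>?I2\<close> of two cycles and the interior of the drawn ear. An edge off \<open>C\<close>
  and \<open>R\<close> has a connected interior that misses \<open>R\<close>, hence lies in one of
  the two regions. Each new cycle contains \<open>R\<close> once and lacks one path of
  \<open>C\<close>, which gives the length identity and the strict inclusions.\<close>

lemma ear_split:
  assumes bound: "bounding_cycle V E p \<gamma> C"
    and R: "edge_path R a b" "R \<subseteq> E - C" "\<Union>R \<inter> \<Union>C = {a, b}"
  obtains V1 E1 C1 V2 E2 C2 where
    "plane_graph V1 E1 p \<gamma>" "bounding_cycle V1 E1 p \<gamma> C1"
    "plane_graph V2 E2 p \<gamma>" "bounding_cycle V2 E2 p \<gamma> C2"
    "V = V1 \<union> V2" "E = E1 \<union> E2" "V1 \<inter> V2 = \<Union>R" "E1 \<inter> E2 = R"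
    "card C1 + card C2 = card C + 2 * card R" "E1 \<subset> E" "E2 \<subset> E"
proof -
  have C: "C \<subseteq> E" "cycle C" and Vin: "\<And>v. v \<in> V \<Longrightarrow> v \<notin> \<Union>C \<Longrightarrow> p v \<in> inside (curve \<gamma> C)"
    and Ein: "\<And>e. e \<in> E \<Longrightarrow> e \<notin> C \<Longrightarrow> open_arc p \<gamma> e \<subseteq> inside (curve \<gamma> C)"
    using bound unfolding bounding_cycle_def by blast+
  have ab: "a \<in> \<Union>C" "b \<in> \<Union>C" "a \<noteq> b" using R(3) edge_path_ends(1)[OF R(1)] by blast+
  obtain P Q where "cycle_at P Q a b" and CPQ: "C = P \<union> Q"
    using cycle_split[OF C(2) ab] by blast
  then have P: "edge_path P a b" and Q: "edge_path Q a b" and PQ: "\<Union>P \<inter> \<Union>Q = {a, b}" "P \<inter> Q = {}"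
    unfolding cycle_at_def by blast+
  have sub: "P \<subseteq> E" "Q \<subseteq> E" "R \<subseteq> E" using C R CPQ by blast+
  have disj: "P \<inter> R = {}" "Q \<inter> R = {}" using R(2) CPQ by blast+
  have PR: "\<Union>P \<inter> \<Union>R = {a, b}"
    using R(3) CPQ edge_path_ends(2,3)[OF P] edge_path_ends(2,3)[OF R(1)] by blast
  have QR: "\<Union>Q \<inter> \<Union>R = {a, b}"
    using R(3) CPQ edge_path_ends(2,3)[OF Q] edge_path_ends(2,3)[OF R(1)] by blast
  have cyc1: "cycle (P \<union> R)" and cyc2: "cycle (Q \<union> R)"
    using P Q R(1) PR QR disj unfolding cycle_def cycle_at_def by blast+
  obtain g1 where g1: "arc g1" "path_image g1 = curve \<gamma> P" "pathstart g1 = p a" "pathfinish g1 = p b"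
    using path_arc[OF P sub(1)] by blast
  obtain g2 where g2: "arc g2" "path_image g2 = curve \<gamma> Q" "pathstart g2 = p a" "pathfinish g2 = p b"
    using path_arc[OF Q sub(2)] by blast
  obtain g where g: "arc g" "path_image g = curve \<gamma> R" "pathstart g = p a" "pathfinish g = p b"
    using path_arc[OF R(1) sub(3)] by blast
  have abV: "a \<in> V" "b \<in> V" using ab Union_edges[OF C(1)] by blast+
  then have pab: "p a \<noteq> p b" using ab(3) inj_p by (meson inj_onD)
  let ?I = "inside (curve \<gamma> C)"
  let ?I1 = "inside (curve \<gamma> (P \<union> R))" and ?I2 = "inside (curve \<gamma> (Q \<union> R))"
  have int: "curve \<gamma> P \<inter> curve \<gamma> Q = {p a, p b}" "curve \<gamma> P \<inter> curve \<gamma> R = {p a, p b}"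
    "curve \<gamma> Q \<inter> curve \<gamma> R = {p a, p b}"
    using curve_Int sub PQ PR QR disj by simp_all
  \<comment> \<open>The theta-curve theorem requires the middle branch to meet the inside of the
    other two; any edge of \<open>R\<close> shows this, since it is not in \<open>C\<close>.\<close>
  have ne: "curve \<gamma> R \<inter> inside (curve \<gamma> P \<union> curve \<gamma> Q) \<noteq> {}"
  proof -
    obtain e where e: "e \<in> R" using edge_path_nonempty[OF R(1)] by blast
    then have "open_arc p \<gamma> e \<subseteq> curve \<gamma> R" by (auto simp: open_arc_def curve_def)
    moreover have "open_arc p \<gamma> e \<subseteq> ?I" using Ein e R(2) by blast
    moreover have "open_arc p \<gamma> e \<noteq> {}" using open_arc_connected(2) e sub(3) by blast
    ultimately show ?thesis using CPQ curve_Un[of \<gamma> P Q] by auto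
  qed
  have split: "?I1 \<inter> ?I2 = {}" "?I1 \<union> ?I2 \<union> (curve \<gamma> R - {p a, p b}) = ?I"
    using split_inside_simple_closed_curve[OF arc_imp_simple_path[OF g1(1)] g1(3,4)
        arc_imp_simple_path[OF g2(1)] g2(3,4) arc_imp_simple_path[OF g(1)] g(3,4) pab,
        unfolded g1(2) g2(2) g(2), OF int ne]
    unfolding CPQ curve_Un by blast+
  have op: "open ?I1" "open ?I2"
    using sub by (auto intro!: open_inside compact_imp_closed compact_curve)
  define V1 where "V1 = {v \<in> V. v \<in> \<Union>(P \<union> R) \<or> p v \<in> ?I1}"
  define V2 where "V2 = {v \<in> V. v \<in> \<Union>(Q \<union> R) \<or> p v \<in> ?I2}"
  define E1 where "E1 = (P \<union> R) \<union> {e \<in> E - (P \<union> R). open_arc p \<gamma> e \<subseteq> ?I1}"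
  define E2 where "E2 = (Q \<union> R) \<union> {e \<in> E - (Q \<union> R). open_arc p \<gamma> e \<subseteq> ?I2}"
  have part1: "plane_graph V1 E1 p \<gamma>" "bounding_cycle V1 E1 p \<gamma> (P \<union> R)"
    using disc_part[OF _ cyc1 V1_def E1_def] sub by blast+
  have part2: "plane_graph V2 E2 p \<gamma>" "bounding_cycle V2 E2 p \<gamma> (Q \<union> R)"
    using disc_part[OF _ cyc2 V2_def E2_def] sub by blast+
  have I_sub: "?I1 \<subseteq> ?I" "?I2 \<subseteq> ?I" using split(2) by blast+
  have off: "?I \<inter> curve \<gamma> C = {}" by (rule inside_no_overlap)
  have edge_side: "open_arc p \<gamma> e \<subseteq> ?I1 \<or> open_arc p \<gamma> e \<subseteq> ?I2" if e: "e \<in> E" "e \<notin> C" "e \<notin> R" for e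
  proof -
    have "open_arc p \<gamma> e \<inter> curve \<gamma> R = {}" using open_arc_avoids[OF sub(3) e(1,3)] .
    then have cover: "open_arc p \<gamma> e \<subseteq> ?I1 \<union> ?I2" using Ein[OF e(1,2)] split(2) by blast
    show ?thesis
      using connectedD[OF open_arc_connected(1)[OF e(1)] op _ cover] split(1) cover by blast
  qed
  have not_both: "\<not> (open_arc p \<gamma> e \<subseteq> ?I1 \<and> open_arc p \<gamma> e \<subseteq> ?I2)" if "e \<in> E" for e
    using open_arc_connected(2)[OF that] split(1) by blast
  have C_off: "\<not> open_arc p \<gamma> e \<subseteq> ?I" if "e \<in> C" for e
  proof -
    have "open_arc p \<gamma> e \<subseteq> curve \<gamma> C" using that by (auto simp: open_arc_def curve_def)
    then show ?thesis using open_arc_connected(2)[of e] that C(1) off by blast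
  qed
  have notin1: "e \<notin> E1" if "e \<in> Q" for e
    using that C_off[of e] I_sub CPQ PQ(2) disj unfolding E1_def by blast
  have notin2: "e \<notin> E2" if "e \<in> P" for e
    using that C_off[of e] I_sub CPQ PQ(2) disj unfolding E2_def by blast
  have E: "E = E1 \<union> E2"
    using edge_side sub CPQ unfolding E1_def E2_def by blast
  have ER: "E1 \<inter> E2 = R"
  proof
    show "R \<subseteq> E1 \<inter> E2" unfolding E1_def E2_def by blast
    show "E1 \<inter> E2 \<subseteq> R"
    proof
      fix e assume e: "e \<in> E1 \<inter> E2"
      then have "e \<notin> P" "e \<notin> Q" using notin1 notin2 by blast+
      then show "e \<in> R" using e not_both unfolding E1_def E2_def by blast
    qed
  qed
  have vs: "p v \<in> ?I1 \<or> p v \<in> ?I2" if v: "v \<in> V" "v \<notin> \<Union>C" "v \<notin> \<Union>R" for v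
    using Vin[OF v(1,2)] split(2) vertex_on_curve[OF sub(3) v(1)] v(3) by blast
  have V: "V = V1 \<union> V2"
  proof
    show "V \<subseteq> V1 \<union> V2"
    proof
      fix v assume "v \<in> V"
      then show "v \<in> V1 \<union> V2" using vs[of v] CPQ unfolding V1_def V2_def by auto
    qed
  qed (auto simp: V1_def V2_def)
  have offC: "p v \<notin> ?I" if "v \<in> \<Union>C" "v \<in> V" for v
    using vertex_on_curve[OF C(1) that(2)] that(1) off by blast
  have offR: "p v \<notin> ?I1" "p v \<notin> ?I2" if "v \<in> \<Union>R" "v \<in> V" for v
  proof -
    have "p v \<in> curve \<gamma> R" using vertex_on_curve[OF sub(3) that(2)] that(1) by blast
    then have "p v \<in> curve \<gamma> (P \<union> R)" "p v \<in> curve \<gamma> (Q \<union> R)" by (simp_all add: curve_Un)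
    then show "p v \<notin> ?I1" "p v \<notin> ?I2" using inside_no_overlap by blast+
  qed
  have VR: "V1 \<inter> V2 = \<Union>R"
  proof
    show "\<Union>R \<subseteq> V1 \<inter> V2" using Union_edges[OF sub(3)] unfolding V1_def V2_def by blast
    show "V1 \<inter> V2 \<subseteq> \<Union>R"
    proof (rule ccontr)
      assume "\<not> V1 \<inter> V2 \<subseteq> \<Union>R"
      then obtain v where v: "v \<in> V" "v \<in> \<Union>P \<or> p v \<in> ?I1" "v \<in> \<Union>Q \<or> p v \<in> ?I2" "v \<notin> \<Union>R"
        unfolding V1_def V2_def by blast
      have "v \<in> \<Union>P \<Longrightarrow> p v \<notin> ?I2" "v \<in> \<Union>Q \<Longrightarrow> p v \<notin> ?I1"
        using offC[of v] v(1) I_sub CPQ by blast+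
      then have "v \<in> \<Union>P \<inter> \<Union>Q" using v split(1) by blast
      then show False using PQ(1) PR v(4) by blast
    qed
  qed
  have fin: "finite P" "finite Q" "finite R"
    using edge_path_finite(1)[OF P] edge_path_finite(1)[OF Q] edge_path_finite(1)[OF R(1)] .
  have card: "card (P \<union> R) + card (Q \<union> R) = card C + 2 * card R"
    using fin disj PQ(2) CPQ by (simp add: card_Un_disjoint)
  have "E1 \<subset> E" "E2 \<subset> E"
    using E notin1 notin2 edge_path_nonempty[OF P] edge_path_nonempty[OF Q] sub by blast+
  then show thesis using that[OF part1 part2 V E VR ER card] by blast
qed

end

section \<open>Inversion of the plane and the two sides of a cycle\<close>

lemma plane_drawingI:
  assumes "inj_on p V" "\<And>e. e \<in> E \<Longrightarrow> arc (\<gamma> e)"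
   "\<And>e. e \<in> E \<Longrightarrow> {pathstart (\<gamma> e), pathfinish (\<gamma> e)} = p ` e"
   "\<And>e. e \<in> E \<Longrightarrow> path_image (\<gamma> e) \<inter> p ` V = p ` e"
   "\<And>e f. e \<in> E \<Longrightarrow> f \<in> E \<Longrightarrow> e \<noteq> f \<Longrightarrow> path_image (\<gamma> e) \<inter> path_image (\<gamma> f) = p ` (e \<inter> f)"
  shows "plane_drawing V E p \<gamma>"
  using assms by (simp add: plane_drawing_def)

lemma unbounded_connected_outside:
  fixes K :: "complex set"
  assumes "connected B" "\<not> bounded B" "B \<inter> K = {}"
  shows "B \<subseteq> outside K"
proof
  fix x assume x: "x \<in> B"
  have "B \<subseteq> connected_component_set (- K) x"
    using assms x by (intro connected_component_maximal) auto
  then have "\<not> bounded (connected_component_set (- K) x)" using assms(2) bounded_subset by blast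
  then show "x \<in> outside K" by (simp add: outside)
qed

text \<open>Inversion about a point of the inside maps the inside, minus the centre, to an unbounded connected set.\<close>

lemma inversion_outside:
  fixes c :: "real \<Rightarrow> complex"
  assumes c: "simple_path c" "pathfinish c = pathstart c" and q: "q \<in> inside (path_image c)"
  defines "f \<equiv> \<lambda>z. inverse (z - q)"
  shows "f ` outside (path_image c) \<subseteq> inside (f ` path_image c)"
proof -
  let ?K = "path_image c"
  note J = Jordan_inside_outside[OF c]
  have qK: "q \<notin> ?K" using q inside_no_overlap by blast
  have inj: "inj f" by (auto simp: f_def inj_def)
  have cont: "continuous_on S f" if "q \<notin> S" for S
    unfolding f_def using that by (intro continuous_intros) auto
  have c': "simple_path (f \<circ> c)"
    using c(1) cont[OF qK] inj_on_subset[OF inj subset_UNIV] by (rule simple_path_continuous_image)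
  have imc: "path_image (f \<circ> c) = f ` ?K" by (rule path_image_compose)
  have "pathfinish (f \<circ> c) = pathstart (f \<circ> c)" using c(2) by (simp add: pathfinish_compose pathstart_compose)
  note J' = Jordan_inside_outside[OF c' this, unfolded imc]
  define B where "B = f ` (inside ?K - {q})"
  have "connected (inside ?K - {q})" using J by (intro connected_open_delete) auto
  then have connB: "connected B" unfolding B_def by (intro connected_continuous_image cont) auto
  have unbB: "\<not> bounded B"
  proof
    assume "bounded B"
    then obtain M where M: "\<And>w. w \<in> B \<Longrightarrow> norm w \<le> M" by (auto simp: bounded_iff)
    have "open (inside ?K)" using J by blast
    then obtain r where r: "r > 0" "ball q r \<subseteq> inside ?K" using q by (rule openE)
    \<comment> \<open>The point at distance \<open>d\<close> from \<open>q\<close> lies in the ball,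
      and its image has norm \<open>1 / d\<close>, which exceeds \<open>M\<close>.\<close>
    define d where "d = min (r / 2) (1 / (\<bar>M\<bar> + 1))"
    have d: "d > 0" "d \<le> r / 2" "d \<le> 1 / (\<bar>M\<bar> + 1)" using r(1) by (simp_all add: d_def add_nonneg_pos)
    have "q + of_real d \<in> ball q r" using d(1,2) r(1) by (simp add: dist_norm)
    moreover have "q + of_real d \<noteq> q" using d(1) by simp
    ultimately have "q + of_real d \<in> inside ?K - {q}" using r(2) by blast
    then have "f (q + of_real d) \<in> B" unfolding B_def by (rule imageI)
    then have "norm (f (q + of_real d)) \<le> M" by (rule M)
    moreover have "norm (f (q + of_real d)) = inverse d" using d(1) by (simp add: f_def norm_inverse)
    moreover have "\<bar>M\<bar> + 1 \<le> inverse d"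
      using le_imp_inverse_le[OF d(3,1)] by (simp add: inverse_eq_divide)
    ultimately show False by linarith
  qed
  have fInt: "f ` S \<inter> f ` T = f ` (S \<inter> T)" for S T by (rule image_Int[OF inj, symmetric])
  have "(inside ?K - {q}) \<inter> ?K = {}" using inside_no_overlap[of ?K] by blast
  then have "B \<inter> f ` ?K = {}" unfolding B_def fInt by simp
  then have Bout: "B \<subseteq> outside (f ` ?K)" using connB unbB by (intro unbounded_connected_outside)
  define A where "A = f ` outside ?K"
  have q_out: "q \<notin> outside ?K" using q inside_Int_outside[of ?K] by blast
  have connA: "connected A" unfolding A_def using J by (intro connected_continuous_image cont[OF q_out]) auto
  have "A \<inter> f ` ?K = {}" unfolding A_def fInt using outside_no_overlap[of ?K] by simp
  then have A_off: "A \<subseteq> - f ` ?K" by blast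
  have op: "open (inside (f ` ?K))" and ne: "inside (f ` ?K) \<noteq> {}" using J' by simp_all
  have "inside (f ` ?K) \<noteq> {0}"
  proof
    assume eq: "inside (f ` ?K) = {0}"
    have "open {0::complex}" using op unfolding eq .
    then show False using not_open_singleton[of "0::complex"] by (rule notE[rotated])
  qed
  \<comment> \<open>Since \<open>inverse 0 = 0\<close>, the value 0 is taken at the centre
    \<open>q\<close>. A nonzero \<open>w\<close> therefore has a preimage \<open>z\<close> other
    than \<open>q\<close>, and excluding the curve and the inside leaves only the outside for
    \<open>z\<close>. One such point suffices, as the image of the outside is connected.\<close>
  then obtain w where w: "w \<in> inside (f ` ?K)" "w \<noteq> 0" using ne by blast
  define z where "z = q + inverse w"
  have z: "f z = w" "z \<noteq> q" using w(2) by (auto simp: f_def z_def)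
  have zK: "z \<notin> ?K"
  proof
    assume "z \<in> ?K"
    then have "w \<in> f ` ?K" using z(1) imageI[of z ?K f] by simp
    then show False using w(1) inside_no_overlap[of "f ` ?K"] by blast
  qed
  have zI: "z \<notin> inside ?K"
  proof
    assume "z \<in> inside ?K"
    then have "w \<in> B" using z imageI[of z "inside ?K - {q}" f] unfolding B_def by simp
    then have "w \<in> outside (f ` ?K)" using Bout by blast
    then show False using w(1) inside_Int_outside[of "f ` ?K"] by blast
  qed
  have "z \<in> outside ?K" using inside_Un_outside[of ?K] zK zI by blast
  then have wA: "w \<in> A" using z(1) imageI[of z "outside ?K" f] unfolding A_def by simp
  have "A \<subseteq> inside (f ` ?K)"
  proof
    fix u assume uA: "u \<in> A"
    have "connected_component (- f ` ?K) w u"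
      by (rule connected_componentI[OF connA A_off wA uA])
    then show "u \<in> inside (f ` ?K)" using w(1) by (rule inside_same_component)
  qed
  then show ?thesis unfolding A_def .
qed

context plane_graph
begin

lemma cycle_curve:
  assumes "cycle C" "C \<subseteq> E"
  obtains c where "simple_path c" "pathfinish c = pathstart c" "path_image c = curve \<gamma> C"
proof -
  obtain P Q a b where "cycle_at P Q a b" and CPQ: "C = P \<union> Q"
    using assms(1) unfolding cycle_def by blast
  then have P: "edge_path P a b" and Q: "edge_path Q a b" and PQ: "\<Union>P \<inter> \<Union>Q = {a, b}" "P \<inter> Q = {}"
    unfolding cycle_at_def by blast+
  have sub: "P \<subseteq> E" "Q \<subseteq> E" using assms(2) CPQ by blast+
  obtain g1 where g1: "arc g1" "path_image g1 = curve \<gamma> P" "pathstart g1 = p a" "pathfinish g1 = p b"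
    using path_arc[OF P sub(1)] by blast
  obtain g2 where g2: "arc g2" "path_image g2 = curve \<gamma> Q" "pathstart g2 = p a" "pathfinish g2 = p b"
    using path_arc[OF Q sub(2)] by blast
  have "curve \<gamma> P \<inter> curve \<gamma> Q = {p a, p b}" using curve_Int[OF sub PQ(2)] PQ(1) by simp
  then have "simple_path (g1 +++ reversepath g2)"
    using g1 g2 by (intro simple_path_join_loop) (auto simp: arc_reversepath)
  moreover have "path_image (g1 +++ reversepath g2) = curve \<gamma> C"
    using g1 g2 CPQ by (simp add: path_image_join curve_Un)
  ultimately show thesis using that[of "g1 +++ reversepath g2"] g1 g2 by simp
qed

lemma cycle_side:
  assumes "cycle C" "C \<subseteq> E" "e \<in> E" "e \<notin> C"
  shows "open_arc p \<gamma> e \<subseteq> inside (curve \<gamma> C) \<or> open_arc p \<gamma> e \<subseteq> outside (curve \<gamma> C)"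
proof -
  have cl: "closed (curve \<gamma> C)" using compact_curve[OF assms(2)] compact_imp_closed by blast
  have "open_arc p \<gamma> e \<inter> curve \<gamma> C = {}" using open_arc_avoids assms by blast
  then have cover: "open_arc p \<gamma> e \<subseteq> inside (curve \<gamma> C) \<union> outside (curve \<gamma> C)"
    using inside_Un_outside by blast
  have d: "inside (curve \<gamma> C) \<inter> outside (curve \<gamma> C) = {}" by (rule inside_Int_outside)
  show ?thesis
    using connectedD[OF open_arc_connected(1)[OF assms(3)] open_inside[OF cl] open_outside[OF cl] _ cover]
      d cover by blast
qed

text \<open>The centre \<open>q\<close> of the inversion lies inside the cycle, where nothing is
  drawn. So the inversion is continuous and injective on the whole drawing and carries over all
  incidences.\<close>

lemma invert_outside:
  assumes C: "C \<subseteq> E" "cycle C"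
    and out: "\<And>v. v \<in> V \<Longrightarrow> v \<notin> \<Union>C \<Longrightarrow> p v \<in> outside (curve \<gamma> C)"
      "\<And>e. e \<in> E \<Longrightarrow> e \<notin> C \<Longrightarrow> open_arc p \<gamma> e \<subseteq> outside (curve \<gamma> C)"
  obtains p' \<gamma>' where "plane_graph V E p' \<gamma>'" "bounding_cycle V E p' \<gamma>' C"
proof -
  let ?K = "curve \<gamma> C"
  obtain c where c: "simple_path c" "pathfinish c = pathstart c" "path_image c = ?K"
    using cycle_curve[OF C(2,1)] by blast
  obtain q where q: "q \<in> inside ?K" using Jordan_inside_outside[OF c(1,2)] c(3) by auto
  define f where "f = (\<lambda>z. inverse (z - q))"
  have inj: "inj f" by (auto simp: f_def inj_def)
  have maps: "f ` outside ?K \<subseteq> inside (f ` ?K)"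
    using inversion_outside[OF c(1,2)] q unfolding c(3) f_def by blast
  have qK: "q \<notin> ?K" "q \<notin> outside ?K" using q inside_no_overlap inside_Int_outside by blast+
  have pq: "p v \<noteq> q" if "v \<in> V" for v
  proof (cases "v \<in> \<Union>C")
    case True
    then show ?thesis using vertex_on_curve[OF C(1) that] qK by blast
  next
    case False
    then show ?thesis using out(1)[OF that] qK by blast
  qed
  have eq: "q \<notin> path_image (\<gamma> e)" if "e \<in> E" for e
  proof (cases "e \<in> C")
    case True
    then show ?thesis using qK unfolding curve_def by blast
  next
    case False
    then have "q \<notin> open_arc p \<gamma> e" using out(2)[OF that] qK by blast
    moreover have "q \<notin> p ` e" using pq edge_subset[OF that] by blast
    ultimately show ?thesis unfolding open_arc_def by blast
  qed
  define p' where "p' = f \<circ> p"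
  define \<gamma>' where "\<gamma>' = (\<lambda>e. f \<circ> \<gamma> e)"
  have im: "path_image (\<gamma>' e) = f ` path_image (\<gamma> e)" for e
    unfolding \<gamma>'_def by (rule path_image_compose)
  have p'im: "p' ` S = f ` p ` S" for S unfolding p'_def by (rule image_comp[symmetric])
  have arc: "arc (\<gamma>' e)" if "e \<in> E" for e
  proof -
    have that_cont: "continuous_on (path_image (\<gamma> e)) f"
      unfolding f_def using eq[OF that] by (intro continuous_intros) auto
    have "simple_path (\<gamma>' e)"
      unfolding \<gamma>'_def
      using arc_imp_simple_path[OF edge_arc(1)[OF that]] that_cont inj_on_subset[OF inj subset_UNIV]
      by (rule simple_path_continuous_image)
    moreover have "pathfinish (\<gamma>' e) \<noteq> pathstart (\<gamma>' e)"
      using arc_distinct_ends[OF edge_arc(1)[OF that]] inj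
      by (simp add: \<gamma>'_def pathfinish_compose pathstart_compose inj_eq)
    ultimately show ?thesis by (rule simple_path_imp_arc)
  qed
  have ends: "{pathstart (\<gamma>' e), pathfinish (\<gamma>' e)} = p' ` e" if "e \<in> E" for e
  proof -
    have "{pathstart (\<gamma>' e), pathfinish (\<gamma>' e)} = f ` {pathstart (\<gamma> e), pathfinish (\<gamma> e)}"
      by (simp add: \<gamma>'_def pathfinish_compose pathstart_compose)
    then show ?thesis unfolding edge_arc(2)[OF that] p'im .
  qed
  have fInt: "f ` A \<inter> f ` B = f ` (A \<inter> B)" for A B by (rule image_Int[OF inj, symmetric])
  have d1: "inj_on p' V"
    unfolding p'_def using inj_p inj_on_subset[OF inj subset_UNIV] by (rule comp_inj_on)
  have d2: "path_image (\<gamma>' e) \<inter> p' ` V = p' ` e" if e: "e \<in> E" for e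
  proof -
    have "path_image (\<gamma>' e) \<inter> p' ` V = f ` (path_image (\<gamma> e) \<inter> p ` V)"
      by (simp only: im p'im fInt)
    then show ?thesis by (simp only: edge_arc(3)[OF e] p'im)
  qed
  have d3: "path_image (\<gamma>' e) \<inter> path_image (\<gamma>' e') = p' ` (e \<inter> e')"
    if e: "e \<in> E" "e' \<in> E" "e \<noteq> e'" for e e'
  proof -
    have "path_image (\<gamma>' e) \<inter> path_image (\<gamma>' e') = f ` (path_image (\<gamma> e) \<inter> path_image (\<gamma> e'))"
      by (simp only: im fInt)
    then show ?thesis by (simp only: edges_Int[OF e] p'im)
  qed
  have "plane_drawing V E p' \<gamma>'"
    by (rule plane_drawingI[OF d1 arc ends d2 d3])
  then have "plane_graph V E p' \<gamma>'" by unfold_locales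
  moreover have K': "curve \<gamma>' C = f ` ?K" by (auto simp: curve_def im)
  have "open_arc p' \<gamma>' e = f ` open_arc p \<gamma> e" for e
    unfolding open_arc_def im p'im by (rule image_set_diff[OF inj, symmetric])
  then have "bounding_cycle V E p' \<gamma>' C"
    unfolding bounding_cycle_def K' using C out maps unfolding p'_def comp_apply by blast
  ultimately show thesis using that by blast
qed

end

section \<open>An Euler-type inequality for plane graphs\<close>

text \<open>The start is inserted by hand because an \<open>edge_path\<close> has at least one edge
  and distinct ends.\<close>

definition reach :: "'a set set \<Rightarrow> 'a \<Rightarrow> 'a set" where
  "reach E a = insert a {v. \<exists>P\<subseteq>E. edge_path P a v}"

lemma reach_self: "a \<in> reach E a"
  by (simp add: reach_def)

lemma reach_edge:
  assumes "v \<in> reach E a" "{v, w} \<in> E" "v \<noteq> w"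
  shows "w \<in> reach E a"
proof (cases "w = a")
  case False
  show ?thesis
  proof (cases "v = a")
    case True
    have "edge_path {{a, w}} a w" using False by (intro edge_path.edge) simp
    then show ?thesis using assms(2) True unfolding reach_def by blast
  next
    case v: False
    then obtain P where P: "P \<subseteq> E" "edge_path P a v" using assms(1) unfolding reach_def by blast
    obtain Q where "Q \<subseteq> insert {v, w} P" "edge_path Q a w"
      using edge_path_extend[OF P(2) False assms(3)[symmetric]] by blast
    then show ?thesis using P(1) assms(2) unfolding reach_def by blast
  qed
qed (simp add: reach_self)

lemma reach_subset: "reach E a \<subseteq> insert a (\<Union>E)"
proof
  fix v assume "v \<in> reach E a"
  then consider "v = a" | P where "P \<subseteq> E" "edge_path P a v" unfolding reach_def by blast
  then show "v \<in> insert a (\<Union>E)"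
  proof cases
    case 2
    then show ?thesis using edge_path_ends(3)[OF 2(2)] by blast
  qed simp
qed

context simple_graph
begin

lemma edge_obtain:
  assumes "e \<in> E"
  obtains a b where "e = {a, b}" "a \<noteq> b" "a \<in> V" "b \<in> V"
  using edge_card[OF assms] edge_subset[OF assms] that by (auto simp: card_2_iff)

lemma edge_obtain_at:
  assumes "e \<in> E" "a \<in> e"
  obtains b where "e = {a, b}" "a \<noteq> b" "a \<in> V" "b \<in> V"
proof -
  obtain x y where "e = {x, y}" "x \<noteq> y" "x \<in> V" "y \<in> V" using edge_obtain[OF assms(1)] .
  then show thesis using assms(2) that[of y] that[of x] by (auto simp: insert_commute)
qed

lemma triangles_finite: "finite (triangles E)"
proof -
  have "\<Union>E \<subseteq> V" using edge_subset by blast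
  then show ?thesis using finite_triangles finite_verts finite_subset by metis
qed

text \<open>Triangle counts are superadditive up to the triangles of the common edges. That
  correction vanishes when the parts share a path or no edge, and is at most 1 when they share a
  cycle.\<close>

lemma triangles_split:
  assumes "E1 \<subseteq> E" "E2 \<subseteq> E"
  shows "card (triangles E1) + card (triangles E2) \<le> card (triangles E) + card (triangles (E1 \<inter> E2))"
proof -
  have sub: "triangles E1 \<union> triangles E2 \<subseteq> triangles E"
    using triangles_mono[OF assms(1)] triangles_mono[OF assms(2)] by simp
  then have fin: "finite (triangles E1)" "finite (triangles E2)"
    using finite_subset[OF _ triangles_finite] by simp_all
  have "card (triangles E1) + card (triangles E2)
      = card (triangles E1 \<union> triangles E2) + card (triangles (E1 \<inter> E2))"
    using card_Un_Int[OF fin] by (simp only: triangles_Int)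
  then show ?thesis using card_mono[OF triangles_finite sub] by simp
qed

end

text \<open>Euler's formula for a disc: with \<open>f = |E| - |V| + 1\<close> inner faces of length
  at least 4 unless they are triangles, counting edge sides gives
  \<open>2|E| - |C| \<ge> 4f - t\<close>. Replacing triangular faces by triangles of the graph only
  weakens the bound.\<close>

definition disc_bound :: "'a set \<Rightarrow> 'a set set \<Rightarrow> 'a set set \<Rightarrow> bool" where
  "disc_bound V E C \<longleftrightarrow> 2 * card E + card C + 4 \<le> 4 * card V + card (triangles E)"

text \<open>The constant 4 is the largest that a single vertex permits.\<close>

definition euler_bound :: "'a set \<Rightarrow> 'a set set \<Rightarrow> bool" where
  "euler_bound V E \<longleftrightarrow> 2 * card E + 4 \<le> 4 * card V + card (triangles E)"

lemma triangles_empty: "triangles {} = {}"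
proof -
  have "T \<notin> triangles {}" for T
  proof
    assume T: "T \<in> triangles {}"
    then have "T \<subseteq> \<Union>{}" by (rule triangle_subset)
    then show False using T by (simp add: triangles_def)
  qed
  then show ?thesis by blast
qed

text \<open>The claim reduces to \<open>4 \<le> |C| + t\<close>: a cycle of length 3 makes up the
  deficit by being a triangle itself.\<close>

lemma disc_bound_cycle:
  assumes "cycle C"
  shows "disc_bound (\<Union>C) C C"
  using cycle_card[OF assms] cycle_card_ge_3[OF assms] cycle_triangles[OF assms]
  by (simp add: disc_bound_def)

context plane_graph
begin

text \<open>In the sum of the disc bounds of the two sides, \<open>|C|\<close> cancels, because the
  sides share the \<open>|C|\<close> vertices and the \<open>|C|\<close> edges of the cycle. If
  \<open>C\<close> is a triangle it is counted twice, which costs 1. The hypothesis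
  \<open>disc\<close> ranges over all drawings, since the outer side becomes a disc only after
  inversion.\<close>

lemma two_sides:
  assumes C: "C \<subseteq> E" "cycle C"
    and disc: "\<And>V' E' p' \<gamma>'. E' \<subseteq> E \<Longrightarrow> plane_graph V' E' p' \<gamma>' \<Longrightarrow>
      bounding_cycle V' E' p' \<gamma>' C \<Longrightarrow> disc_bound V' E' C"
  shows "2 * card E + 8 \<le> 4 * card V + card (triangles E) + (if card C = 3 then 1 else 0)"
proof -
  let ?I = "inside (curve \<gamma> C)" and ?O = "outside (curve \<gamma> C)"
  define V1 where "V1 = {v \<in> V. v \<in> \<Union>C \<or> p v \<in> ?I}"
  define V2 where "V2 = {v \<in> V. v \<in> \<Union>C \<or> p v \<in> ?O}"
  define E1 where "E1 = C \<union> {e \<in> E - C. open_arc p \<gamma> e \<subseteq> ?I}"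
  define E2 where "E2 = C \<union> {e \<in> E - C. open_arc p \<gamma> e \<subseteq> ?O}"
  have sub: "V1 \<subseteq> V" "V2 \<subseteq> V" "E1 \<subseteq> E" "E2 \<subseteq> E"
    using C(1) unfolding V1_def V2_def E1_def E2_def by blast+
  have d1: "disc_bound V1 E1 C"
    using disc[OF sub(3) disc_part[OF C V1_def E1_def]] .
  have P2: "plane_graph V2 E2 p \<gamma>"
    by (rule side_part[OF C(1) closure_outside_subset[OF closed_curve[OF C(1)]] V2_def E2_def])
  have "C \<subseteq> E2" unfolding E2_def by blast
  moreover have "p v \<in> ?O" if "v \<in> V2" "v \<notin> \<Union>C" for v using that unfolding V2_def by blast
  moreover have "open_arc p \<gamma> e \<subseteq> ?O" if "e \<in> E2" "e \<notin> C" for e using that unfolding E2_def by blast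
  ultimately obtain p' \<gamma>' where "plane_graph V2 E2 p' \<gamma>'" "bounding_cycle V2 E2 p' \<gamma>' C"
    by (rule plane_graph.invert_outside[OF P2 _ C(2)])
  then have d2: "disc_bound V2 E2 C" by (rule disc[OF sub(4)])
  have IO: "?I \<inter> ?O = {}" "?I \<union> ?O = - curve \<gamma> C" by (rule inside_Int_outside inside_Un_outside)+
  have E: "E1 \<union> E2 = E"
  proof
    show "E \<subseteq> E1 \<union> E2"
    proof
      fix e assume e: "e \<in> E"
      show "e \<in> E1 \<union> E2"
      proof (cases "e \<in> C")
        case False
        then show ?thesis using cycle_side[OF C(2,1) e False] e by (simp add: E1_def E2_def)
      qed (simp add: E1_def)
    qed
  qed (use sub in simp)
  have EC: "E1 \<inter> E2 = C"
  proof
    show "E1 \<inter> E2 \<subseteq> C"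
    proof
      fix e assume e: "e \<in> E1 \<inter> E2"
      show "e \<in> C"
      proof (rule ccontr)
        assume "e \<notin> C"
        then have sides: "open_arc p \<gamma> e \<subseteq> ?I" "open_arc p \<gamma> e \<subseteq> ?O" and eE: "e \<in> E"
          using e by (simp_all add: E1_def E2_def)
        have "open_arc p \<gamma> e \<subseteq> ?I \<inter> ?O" by (rule Int_greatest[OF sides])
        then show False using open_arc_connected(2)[OF eE] unfolding IO(1) by blast
      qed
    qed
    show "C \<subseteq> E1 \<inter> E2" unfolding E1_def E2_def by blast
  qed
  have V: "V1 \<union> V2 = V"
  proof
    show "V \<subseteq> V1 \<union> V2"
    proof
      fix v assume v: "v \<in> V"
      show "v \<in> V1 \<union> V2"
      proof (cases "v \<in> \<Union>C")
        case False
        then have "p v \<in> ?I \<union> ?O" unfolding IO(2) using vertex_on_curve[OF C(1) v] by simp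
        then have "p v \<in> ?I \<or> p v \<in> ?O" by (simp only: Un_iff)
        then show ?thesis using v by (auto simp: V1_def V2_def)
      qed (use v in \<open>simp add: V1_def\<close>)
    qed
  qed (use sub in blast)
  have VC: "V1 \<inter> V2 = \<Union>C"
    using disjoint_iff[THEN iffD1, OF IO(1)] Union_edges[OF C(1)] by (auto simp: V1_def V2_def)
  have fin: "finite V1" "finite V2" "finite E1" "finite E2"
    using finite_subset[OF sub(1) finite_verts] finite_subset[OF sub(2) finite_verts]
      finite_subset[OF sub(3) finite_edges] finite_subset[OF sub(4) finite_edges] .
  have "card E1 + card E2 = card E + card C" using card_Un_Int[OF fin(3,4)] E EC by simp
  moreover have "card V1 + card V2 = card V + card C"
    using card_Un_Int[OF fin(1,2)] V VC cycle_card[OF C(2)] by simp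
  moreover have "card (triangles E1) + card (triangles E2)
      \<le> card (triangles E) + (if card C = 3 then 1 else 0)"
    using triangles_split[OF sub(3,4)] cycle_triangles[OF C(2)] unfolding EC by (simp split: if_splits)
  ultimately show ?thesis using d1 d2 unfolding disc_bound_def by linarith
qed

end

text \<open>The bound for the disc is additive, with equality, when an ear splits the disc in two; a part
  hanging on at most one vertex of the boundary is cut off instead and treated by the general bound.\<close>

lemma disc_bound_step:
  assumes G: "plane_graph V E p \<gamma>" and C: "bounding_cycle V E p \<gamma> C"
    and disc: "\<And>V' E' C'. E' \<subset> E \<Longrightarrow> plane_graph V' E' p \<gamma> \<Longrightarrow>
      bounding_cycle V' E' p \<gamma> C' \<Longrightarrow> disc_bound V' E' C'"
    and euler: "\<And>V' E'. E' \<subset> E \<Longrightarrow> V' \<noteq> {} \<Longrightarrow> plane_graph V' E' p \<gamma> \<Longrightarrow> euler_bound V' E'"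
  shows "disc_bound V E C"
proof -
  interpret plane_graph V E p \<gamma> by (rule G)
  have CE: "C \<subseteq> E" and cyc: "cycle C"
    and Vin: "\<And>v. v \<in> V \<Longrightarrow> v \<notin> \<Union>C \<Longrightarrow> p v \<in> inside (curve \<gamma> C)"
    and Ein: "\<And>e. e \<in> E \<Longrightarrow> e \<notin> C \<Longrightarrow> open_arc p \<gamma> e \<subseteq> inside (curve \<gamma> C)"
    using C unfolding bounding_cycle_def by simp_all
  have Cne: "C \<noteq> {}" using cycle_card_ge_3[OF cyc] by auto
  have UC: "\<Union>C \<subseteq> V" using Union_edges[OF CE] .
  define F where "F = {e \<in> E. e \<inter> \<Union>C = {}}"
  have F: "F \<subseteq> E" "F \<inter> C = {}" "\<Union>F \<inter> \<Union>C = {}"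
  proof -
    have "e \<notin> F" if e: "e \<in> C" for e
    proof -
      have "card e = 2" using edge_card CE e by blast
      then have "e \<noteq> {}" by auto
      then show ?thesis using e unfolding F_def by blast
    qed
    then show "F \<inter> C = {}" by blast
  qed (auto simp: F_def)
  show ?thesis
  proof (cases "\<exists>R a b. edge_path R a b \<and> R \<subseteq> E - C \<and> \<Union>R \<inter> \<Union>C = {a, b}")
    case True
    then obtain R a b where R: "edge_path R a b" "R \<subseteq> E - C" "\<Union>R \<inter> \<Union>C = {a, b}" by blast
    obtain V1 E1 C1 V2 E2 C2 where
      1: "plane_graph V1 E1 p \<gamma>" "bounding_cycle V1 E1 p \<gamma> C1"
      and 2: "plane_graph V2 E2 p \<gamma>" "bounding_cycle V2 E2 p \<gamma> C2"
      and un: "V = V1 \<union> V2" "E = E1 \<union> E2" and int: "V1 \<inter> V2 = \<Union>R" "E1 \<inter> E2 = R"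
      and len: "card C1 + card C2 = card C + 2 * card R" and less: "E1 \<subset> E" "E2 \<subset> E"
      by (rule ear_split[OF C R])
    have d: "disc_bound V1 E1 C1" "disc_bound V2 E2 C2"
      by (rule disc[OF less(1) 1] disc[OF less(2) 2])+
    have fin: "finite V1" "finite V2" "finite E1" "finite E2"
      using finite_verts finite_edges un by simp_all
    have "card E1 + card E2 = card E + card R" using card_Un_Int[OF fin(3,4)] un int by simp
    moreover have "card V1 + card V2 = card V + card R + 1"
      using card_Un_Int[OF fin(1,2)] un int edge_path_card[OF R(1)] by simp
    moreover have "card (triangles E1) + card (triangles E2) \<le> card (triangles E)"
      using triangles_split[of E1 E2] less edge_path_no_triangle[OF R(1)] int(2) by auto
    \<comment> \<open>The contributions of the ear cancel: \<open>4 (|R| + 1)\<close> from the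
      shared vertices stands against \<open>2|R|\<close> from the shared edges, \<open>2|R|\<close>
      from the boundary lengths and the second constant 4.\<close>
    ultimately show ?thesis using d len unfolding disc_bound_def by linarith
  next
    case False
    have no_ear: False if "edge_path R a b" "R \<subseteq> E - C" "\<Union>R \<inter> \<Union>C = {a, b}" for R a b
      using False that by blast
    show ?thesis
    proof (cases "\<exists>a w. {a, w} \<in> E \<and> a \<in> \<Union>C \<and> w \<notin> \<Union>C")
      case True
      then obtain a w where aw: "{a, w} \<in> E" "a \<in> \<Union>C" "w \<notin> \<Union>C" by blast
      have wV: "w \<in> V" using edge_subset[OF aw(1)] by blast
      \<comment> \<open>The component of \<open>w\<close> in the graph of edges that avoid
        \<open>C\<close>. In the absence of ears it can be attached to \<open>C\<close> at
        \<open>a\<close> only.\<close>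
      define S where "S = reach F w"
      have S: "S \<subseteq> V - \<Union>C"
      proof -
        have "\<Union>F \<subseteq> V" using Union_edges[OF F(1)] .
        then show ?thesis using reach_subset[of F w] F(3) wV aw(3) unfolding S_def by blast
      qed
      define E' where "E' = {e \<in> E. e \<inter> S \<noteq> {}}"
      have sub: "e \<subseteq> insert a S" if e: "e \<in> E'" for e
      proof -
        obtain s where s: "s \<in> e" "s \<in> S" "e \<in> E" using e unfolding E'_def by blast
        obtain t where t: "e = {s, t}" "s \<noteq> t" "t \<in> V" using edge_obtain_at[OF s(3,1)] by blast
        have sC: "s \<notin> \<Union>C" using s(2) S by blast
        have "t \<in> insert a S"
        proof (cases "t \<in> \<Union>C")
          case False
          then have "{s, t} \<in> F" using s(3) t(1) sC unfolding F_def by blast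
          then show ?thesis using reach_edge[of s F w t] s(2) t(2) unfolding S_def by blast
        next
          case tC: True
          show ?thesis
          proof (rule ccontr)
            assume "t \<notin> insert a S"
            then have ta: "t \<noteq> a" by blast
            \<comment> \<open>A path from \<open>a\<close> to \<open>s\<close> that meets
              \<open>C\<close> in \<open>a\<close> only; appending \<open>{s, t}\<close> turns it
              into an ear from \<open>a\<close> to \<open>t\<close>.\<close>
            have "\<exists>P\<subseteq>insert {a, w} F. edge_path P a s \<and> \<Union>P \<inter> \<Union>C = {a}"
            proof (cases "s = w")
              case True
              then show ?thesis using aw edge_path.edge[of a w] by (intro exI[of _ "{{a, w}}"]) auto
            next
              case False
              then obtain P where P: "P \<subseteq> F" "edge_path P w s"
                using s(2) unfolding S_def reach_def by blast
              have PC: "\<Union>P \<inter> \<Union>C = {}" using P(1) F(3) by blast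
              then have "edge_path (insert {a, w} P) a s"
                using edge_path.step[OF P(2), of a] aw(2) by blast
              moreover have "\<Union>(insert {a, w} P) \<inter> \<Union>C = {a}" using PC aw(2,3) by auto
              ultimately show ?thesis using P(1) by (intro exI[of _ "insert {a, w} P"]) auto
            qed
            then obtain P where P: "P \<subseteq> insert {a, w} F" "edge_path P a s" "\<Union>P \<inter> \<Union>C = {a}" by blast
            have "t \<notin> \<Union>P" using P(3) tC ta by blast
            then have "edge_path (insert {s, t} P) a t" using edge_path_snoc[OF P(2)] by blast
            moreover have "insert {s, t} P \<subseteq> E - C"
            proof -
              have "{s, t} \<in> E - C" using s(3) t(1) sC by blast
              moreover have "{a, w} \<in> E - C" using aw by blast
              ultimately show ?thesis using P(1) F(1,2) by blast
            qed
            moreover have "\<Union>(insert {s, t} P) \<inter> \<Union>C = {a, t}" using P(3) tC sC by auto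
            ultimately show False by (rule no_ear)
          qed
        qed
        then show ?thesis using t(1) s(2) by blast
      qed
      have E'C: "E' \<inter> C = {}" using S unfolding E'_def by blast
      have E'E: "E' \<subseteq> E" unfolding E'_def by blast
      have aV: "a \<in> V" using aw(2) UC by blast
      have "insert a S \<subseteq> V" using S aV by blast
      then have G': "plane_graph (insert a S) E' p \<gamma>"
        by (rule subgraph[OF _ E'E sub])
      have "E' \<subset> E" using E'C E'E Cne CE by blast
      then have e': "euler_bound (insert a S) E'"
        by (rule euler[OF _ insert_not_empty G'])
      have G0: "plane_graph (V - S) (E - E') p \<gamma>"
      proof (rule subgraph)
        fix e assume "e \<in> E - E'"
        then show "e \<subseteq> V - S" using edge_subset[of e] unfolding E'_def by blast
      qed auto
      have "bounding_cycle (V - S) (E - E') p \<gamma> C"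
        using C E'C unfolding bounding_cycle_def by blast
      moreover have "E - E' \<subset> E"
      proof -
        have "w \<in> S" unfolding S_def by (rule reach_self)
        then have "{a, w} \<in> E'" using aw(1) unfolding E'_def by blast
        then show ?thesis using E'E by blast
      qed
      ultimately have d0: "disc_bound (V - S) (E - E') C" using disc[OF _ G0] by blast
      have finS: "finite S" using S finite_verts finite_subset by (metis Diff_subset order_trans)
      have aS: "a \<notin> S" using S aw(2) by blast
      have "card S + card (V - S) = card V"
        using S finite_verts card_Diff_subset[OF finS, of V] card_mono[OF finite_verts, of S] by force
      then have "card (insert a S) + card (V - S) = card V + 1" using finS aS by simp
      moreover have "card E' + card (E - E') = card E"
        using card_Diff_subset[OF finite_subset[OF E'E finite_edges] E'E] card_mono[OF finite_edges E'E] by simp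
      moreover have "card (triangles E') + card (triangles (E - E')) \<le> card (triangles E)"
        using triangles_split[of E' "E - E'"] E'E by (simp add: triangles_empty)
      ultimately show ?thesis using e' d0 unfolding disc_bound_def euler_bound_def by linarith
    next
      case isolated: False
      \<comment> \<open>An edge between \<open>C\<close> and a vertex off \<open>C\<close> is
        excluded by the case at hand, and a chord of \<open>C\<close> would be an ear of one
        edge.\<close>
      have E: "E = C \<union> F"
      proof
        show "E \<subseteq> C \<union> F"
        proof
          fix e assume e: "e \<in> E"
          show "e \<in> C \<union> F"
          proof (rule ccontr)
            assume neg: "e \<notin> C \<union> F"
            then obtain a where a: "a \<in> e" "a \<in> \<Union>C" using e unfolding F_def by blast
            obtain b where b: "e = {a, b}" "a \<noteq> b" using edge_obtain_at[OF e a(1)] by blast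
            have "b \<in> \<Union>C" using isolated e a(2) b(1) by blast
            then have ends: "\<Union>{e} \<inter> \<Union>C = {a, b}" using a(2) b(1) by auto
            have "edge_path {e} a b" unfolding b(1) using b(2) by (rule edge_path.edge)
            moreover have "{e} \<subseteq> E - C" using e neg by blast
            ultimately show False using ends by (rule no_ear)
          qed
        qed
      qed (use CE F(1) in blast)
      note base = disc_bound_cycle[OF cyc]
      show ?thesis
      proof (cases "V = \<Union>C")
        case True
        have "f \<notin> F" for f
        proof
          assume f: "f \<in> F"
          then obtain a where a: "a \<in> f" "a \<in> V" using edge_obtain[of f] F(1) by blast
          then show False using f F(3) True by blast
        qed
        then have "F = {}" by blast
        then show ?thesis using base True E by simp
      next
        case False
        have G': "plane_graph (V - \<Union>C) F p \<gamma>"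
        proof (rule subgraph)
          fix e assume "e \<in> F"
          then show "e \<subseteq> V - \<Union>C" using edge_subset[of e] unfolding F_def by blast
        qed (use F(1) in auto)
        have "F \<subset> E" using F Cne CE by blast
        moreover have "V - \<Union>C \<noteq> {}" using False UC by blast
        ultimately have e': "euler_bound (V - \<Union>C) F" by (rule euler[OF _ _ G'])
        have "card (V - \<Union>C) + card (\<Union>C) = card V"
          using card_Diff_subset[OF cycle_finite(2)[OF cyc] UC] card_mono[OF finite_verts UC] by simp
        moreover have "card E = card C + card F"
          unfolding E using F(2) finite_subset[OF F(1) finite_edges] cycle_finite(1)[OF cyc]
          by (simp add: card_Un_disjoint Int_commute)
        moreover have "card (triangles C) + card (triangles F) \<le> card (triangles E)"
          using triangles_split[of C F] CE F(1,2) by (simp add: Int_commute triangles_empty)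
        ultimately show ?thesis using e' base unfolding disc_bound_def euler_bound_def by linarith
      qed
    qed
  qed
qed

text \<open>An edge on a cycle lets the plane be cut along that cycle, which gives at least the
  constant \<open>8 - 1\<close>. A bridge separates the component \<open>S\<close> of
  \<open>a\<close> from a nonempty rest, which gives \<open>4 + 4 - 2\<close>, the 2 being the cost
  of the bridge. Both values suffice for 4.\<close>

lemma euler_bound_step:
  assumes G: "plane_graph V E p \<gamma>" and "V \<noteq> {}"
    and disc: "\<And>V' E' p' \<gamma>' C'. E' \<subseteq> E \<Longrightarrow> plane_graph V' E' p' \<gamma>' \<Longrightarrow>
      bounding_cycle V' E' p' \<gamma>' C' \<Longrightarrow> disc_bound V' E' C'"
    and euler: "\<And>V' E'. E' \<subset> E \<Longrightarrow> V' \<noteq> {} \<Longrightarrow> plane_graph V' E' p \<gamma> \<Longrightarrow> euler_bound V' E'"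
  shows "euler_bound V E"
proof -
  interpret plane_graph V E p \<gamma> by (rule G)
  show ?thesis
  proof (cases "E = {}")
    case True
    have "card V \<ge> 1" using \<open>V \<noteq> {}\<close> finite_verts by (simp add: Suc_le_eq card_gt_0_iff)
    then show ?thesis using True by (simp add: euler_bound_def)
  next
    case False
    then obtain e where e: "e \<in> E" by blast
    obtain a b where ab: "e = {a, b}" "a \<noteq> b" "a \<in> V" "b \<in> V" using edge_obtain[OF e] .
    define F where "F = E - {e}"
    have FE: "F \<subset> E" using e unfolding F_def by blast
    show ?thesis
    proof (cases "b \<in> reach F a")
      case True
      then obtain R where R: "R \<subseteq> F" "edge_path R a b" using ab(2) unfolding reach_def by blast
      have "edge_path {e} a b" unfolding ab(1) using ab(2) by (rule edge_path.edge)
      moreover have "\<Union>{e} \<inter> \<Union>R = {a, b}" using ab(1) edge_path_ends(2,3)[OF R(2)] by auto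
      moreover have "{e} \<inter> R = {}" using R(1) unfolding F_def by blast
      ultimately have cyc: "cycle ({e} \<union> R)" using R(2) unfolding cycle_def cycle_at_def by blast
      have sub: "{e} \<union> R \<subseteq> E" using e R(1) FE by blast
      have "2 * card E + 8 \<le> 4 * card V + card (triangles E)
          + (if card ({e} \<union> R) = 3 then 1 else 0)"
        by (rule two_sides[OF sub cyc disc])
      then show ?thesis by (simp add: euler_bound_def split: if_splits)
    next
      case b: False
      define S where "S = reach F a"
      have S: "S \<subseteq> V" using reach_subset[of F a] ab(3) Union_edges[of F] FE unfolding S_def by blast
      define E1 where "E1 = {f \<in> F. f \<inter> S \<noteq> {}}"
      have sub1: "f \<subseteq> S" if f: "f \<in> E1" for f
      proof -
        obtain s where s: "s \<in> f" "s \<in> S" "f \<in> F" using f unfolding E1_def by blast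
        then have "f \<in> E" using FE by blast
        then obtain t where t: "f = {s, t}" "s \<noteq> t" using edge_obtain_at[OF _ s(1)] by blast
        then have "t \<in> S" using reach_edge[of s F a t] s unfolding S_def by blast
        then show ?thesis using t(1) s(2) by blast
      qed
      have sub2: "f \<subseteq> V - S" if "f \<in> F - E1" for f
        using that edge_subset[of f] FE unfolding E1_def by blast
      have E1: "E1 \<subseteq> F" unfolding E1_def by blast
      have E1E: "E1 \<subset> E" using E1 FE by blast
      have "S \<noteq> {}" using reach_self[of a F] unfolding S_def by blast
      then have b1: "euler_bound S E1"
        by (rule euler[OF E1E _ subgraph[OF S psubset_imp_subset[OF E1E] sub1]])
      have E2E: "F - E1 \<subset> E" using FE by blast
      have "V - S \<noteq> {}" using ab(4) b unfolding S_def by blast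
      then have b2: "euler_bound (V - S) (F - E1)"
        by (rule euler[OF E2E _ subgraph[OF Diff_subset psubset_imp_subset[OF E2E] sub2]])
      have finF: "finite F" using FE finite_edges finite_subset by blast
      have "card S + card (V - S) = card V"
        using card_Diff_subset[OF finite_subset[OF S finite_verts] S] card_mono[OF finite_verts S] by simp
      moreover have "card E1 + card (F - E1) = card F"
        using card_Diff_subset[OF finite_subset[OF E1 finF] E1] card_mono[OF finF E1] by simp
      moreover have "card E = card F + 1"
        using card_Suc_Diff1[OF finite_edges e] unfolding F_def by simp
      moreover have "card (triangles E1) + card (triangles (F - E1)) \<le> card (triangles E)"
      proof -
        have "E1 \<inter> (F - E1) = {}" by blast
        moreover have "E1 \<subseteq> E" "F - E1 \<subseteq> E" using E1 FE by blast+
        ultimately show ?thesis using triangles_split[of E1 "F - E1"] by (simp add: triangles_empty)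
      qed
      ultimately show ?thesis using b1 b2 unfolding euler_bound_def by linarith
    qed
  qed
qed

text \<open>The drawing varies in the induction because \<open>two_sides\<close> inverts it. For a
  given edge set the disc bound comes first and rests on smaller edge sets only; the general bound
  then uses the disc bound for all subsets, \<open>E\<close> itself included.\<close>

lemma plane_bounds:
  assumes "plane_graph V E p \<gamma>"
  shows "(V \<noteq> {} \<longrightarrow> euler_bound V E) \<and> (\<forall>C. bounding_cycle V E p \<gamma> C \<longrightarrow> disc_bound V E C)"
  using assms
proof (induction "card E" arbitrary: V E p \<gamma> rule: less_induct)
  case less
  have fin: "finite E" using plane_graph.finite_edges[OF less.prems] .
  have sm: "card E' < card E" if "E' \<subset> E" for E' using psubset_card_mono[OF fin that] .
  have bounds: "(V' \<noteq> {} \<longrightarrow> euler_bound V' E') \<and> (\<forall>C. bounding_cycle V' E' p' \<gamma>' C \<longrightarrow> disc_bound V' E' C)"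
    if "E' \<subset> E" "plane_graph V' E' p' \<gamma>'" for V' E' p' \<gamma>'
    by (rule less.hyps[OF sm[OF that(1)] that(2)])
  have disc: "disc_bound V' E' C"
    if sub: "E' \<subseteq> E" and G: "plane_graph V' E' p' \<gamma>'" and C: "bounding_cycle V' E' p' \<gamma>' C" for V' E' p' \<gamma>' C
  proof -
    have d: "disc_bound V'' E'' C''"
      if "E'' \<subset> E'" "plane_graph V'' E'' p' \<gamma>'" "bounding_cycle V'' E'' p' \<gamma>' C''" for V'' E'' C''
      using bounds[OF psubset_subset_trans[OF that(1) sub] that(2)] that(3) by simp
    have e: "euler_bound V'' E''"
      if "E'' \<subset> E'" "V'' \<noteq> {}" "plane_graph V'' E'' p' \<gamma>'" for V'' E''
      using bounds[OF psubset_subset_trans[OF that(1) sub] that(3)] that(2) by simp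
    show ?thesis by (rule disc_bound_step[OF G C d e])
  qed
  have euler: "euler_bound V E" if "V \<noteq> {}"
  proof -
    have e: "euler_bound V' E'" if "E' \<subset> E" "V' \<noteq> {}" "plane_graph V' E' p \<gamma>" for V' E'
      using bounds[OF that(1,3)] that(2) by simp
    show ?thesis by (rule euler_bound_step[OF less.prems that disc e])
  qed
  show ?case using euler disc[OF subset_refl less.prems] by blast
qed

theorem planar_edge_bound:
  assumes "simple_graph V E" "planar V E" "C \<subseteq> E" "cycle C" "card C \<ge> 4"
  shows "2 * card E + 8 \<le> 4 * card V + card (triangles E)"
proof -
  obtain p \<gamma> where "plane_drawing V E p \<gamma>" using assms(2) unfolding planar_def by blast
  then have G: "plane_graph V E p \<gamma>"
    using assms(1) by (simp add: plane_graph_def plane_graph_axioms_def)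
  have "2 * card E + 8 \<le> 4 * card V + card (triangles E) + (if card C = 3 then 1 else 0)"
    using plane_bounds by (intro plane_graph.two_sides[OF G assms(3,4)]) blast
  then show ?thesis using assms(5) by simp
qed

section \<open>Colourings as vectors over the field with three elements\<close>

lemma three_cases:
  fixes a :: 3
  obtains "a = 0" | "a = 1" | "a = 2"
  using exhaust_3[of a] by auto

lemma three_times [simp]: "(a :: 3) + a + a = 0" "(a :: 3) + (a + a) = 0" "3 * (a :: 3) = 0"
  by (cases a rule: three_cases; simp)+

lemma distinct_sum_zero:
  fixes a b c :: 3
  assumes "a \<noteq> b" "b \<noteq> c" "a \<noteq> c"
  shows "a + b + c = 0"
  using assms by (cases a rule: three_cases; cases b rule: three_cases; cases c rule: three_cases; simp)

lemma three_mult_eq_0: "(a :: 3) * b = 0 \<longleftrightarrow> a = 0 \<or> b = 0"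
  by (cases a rule: three_cases; cases b rule: three_cases; simp)

lemma three_square: "(a :: 3) \<noteq> 0 \<Longrightarrow> a * a = 1"
  by (cases a rule: three_cases; simp)

lemma three_cover:
  fixes a b c d :: 3
  assumes "a \<noteq> b" "b \<noteq> c" "a \<noteq> c"
  shows "d = a \<or> d = b \<or> d = c"
  using assms
  by (cases a rule: three_cases; cases b rule: three_cases; cases c rule: three_cases; cases d rule: three_cases; simp)

text \<open>Two independent linear equations in three unknowns have a one-dimensional solution
  space. As \<open>a + b + c = 0\<close> and the characteristic is 3, the vector
  \<open>(1, 1, 1)\<close> spans it.\<close>

lemma three_dependence:
  fixes a b c p q r :: 3
  assumes "p + q + r = 0" "p * a + q * b + r * c = 0" "a \<noteq> b" "b \<noteq> c" "a \<noteq> c"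
  shows "q = p \<and> r = p"
proof -
  have abc: "a + b + c = 0" using assms(3-5) by (rule distinct_sum_zero)
  have "(q - p) * (b - c) = (p * a + q * b + r * c) - c * (p + q + r) - p * (a + b + c) + (p * c + p * c + p * c)"
    by (simp add: algebra_simps)
  then have "(q - p) * (b - c) = 0" using assms(1,2) abc by simp
  then have "q = p" using assms(4) by (simp add: three_mult_eq_0)
  moreover have "r = (p + q + r) - (p + q)" by simp
  then have "r = - p - q" using assms(1) by simp
  moreover have "- p - p = p" using three_times(1)[of p] by (simp add: algebra_simps eq_neg_iff_add_eq_0)
  ultimately show ?thesis by simp
qed

section \<open>Spans of indicator functions of triangles\<close>

definition ind :: "'a set \<Rightarrow> 'a \<Rightarrow> 3" where
  "ind T w = (if w \<in> T then 1 else 0)"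

definition tspan :: "'a set set \<Rightarrow> ('a \<Rightarrow> 3) set" where
  "tspan K = {\<psi>. \<exists>c. \<forall>w. \<psi> w = (\<Sum>T\<in>K. c T * ind T w)}"

lemma tspanI: "(\<And>w. \<psi> w = (\<Sum>T\<in>K. c T * ind T w)) \<Longrightarrow> \<psi> \<in> tspan K"
  unfolding tspan_def by blast

lemma tspanE:
  assumes "\<psi> \<in> tspan K"
  obtains c where "\<forall>w. \<psi> w = (\<Sum>T\<in>K. c T * ind T w)"
  using assms unfolding tspan_def by blast

lemma tspan_zero: "(\<lambda>w. 0) \<in> tspan K"
  by (rule tspanI[where c = "\<lambda>_. 0"]) simp

lemma tspan_add:
  assumes "\<psi> \<in> tspan K" "\<eta> \<in> tspan K"
  shows "(\<lambda>w. \<psi> w + \<eta> w) \<in> tspan K"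
proof -
  obtain c where c: "\<forall>w. \<psi> w = (\<Sum>T\<in>K. c T * ind T w)" by (rule tspanE[OF assms(1)])
  obtain d where d: "\<forall>w. \<eta> w = (\<Sum>T\<in>K. d T * ind T w)" by (rule tspanE[OF assms(2)])
  show ?thesis
    by (rule tspanI[where c = "\<lambda>T. c T + d T"]) (simp add: c d sum.distrib distrib_right)
qed

lemma tspan_scale:
  assumes "\<psi> \<in> tspan K"
  shows "(\<lambda>w. a * \<psi> w) \<in> tspan K"
proof -
  obtain c where c: "\<forall>w. \<psi> w = (\<Sum>T\<in>K. c T * ind T w)" by (rule tspanE[OF assms])
  show ?thesis
    by (rule tspanI[where c = "\<lambda>T. a * c T"]) (simp add: c sum_distrib_left mult.assoc)
qed

lemma tspan_mono:
  assumes "\<psi> \<in> tspan K" "K \<subseteq> L" "finite L"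
  shows "\<psi> \<in> tspan L"
proof -
  obtain c where c: "\<forall>w. \<psi> w = (\<Sum>T\<in>K. c T * ind T w)" by (rule tspanE[OF assms(1)])
  show ?thesis
  proof (rule tspanI[where c = "\<lambda>T. if T \<in> K then c T else 0"])
    fix w
    have "(\<Sum>T\<in>K. c T * ind T w) = (\<Sum>T\<in>L. (if T \<in> K then c T else 0) * ind T w)"
      using assms(2,3) by (intro sum.mono_neutral_cong_left) auto
    then show "\<psi> w = \<dots>" using c by simp
  qed
qed

lemma tspan_base:
  assumes "T \<in> K" "finite K"
  shows "ind T \<in> tspan K"
proof (rule tspanI[where c = "\<lambda>S. if S = T then 1 else 0"])
  fix w
  have "(\<Sum>S\<in>K. (if S = T then 1 else 0) * ind S w) = (\<Sum>S\<in>K. if S = T then ind S w else 0)"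
    by (rule sum.cong) simp_all
  then show "ind T w = (\<Sum>S\<in>K. (if S = T then 1 else 0) * ind S w)"
    using assms by simp
qed

lemma tspan_insert:
  assumes "\<psi> \<in> tspan (insert T K)" "T \<notin> K" "finite K"
  obtains a \<sigma> where "\<sigma> \<in> tspan K" "\<forall>w. \<psi> w = a * ind T w + \<sigma> w"
proof -
  obtain c where c: "\<forall>w. \<psi> w = (\<Sum>S\<in>insert T K. c S * ind S w)" by (rule tspanE[OF assms(1)])
  have "(\<lambda>w. \<Sum>S\<in>K. c S * ind S w) \<in> tspan K" by (rule tspanI) simp
  then show thesis using that[of "\<lambda>w. \<Sum>S\<in>K. c S * ind S w" "c T"] c assms(2,3) by simp
qed

text \<open>Keeps of criticality only what the linear algebra uses: a proper \<open>x\<close> and,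
  for each edge, a colouring that fails at that edge alone, by giving both ends the same
  value.\<close>

locale irredundant_graph = simple_graph V E for V :: "'a set" and E :: "'a set set" +
  fixes x :: "'a \<Rightarrow> 3"
  assumes proper: "{u, v} \<in> E \<Longrightarrow> x u \<noteq> x v"
    and irredundant: "e \<in> E \<Longrightarrow>
      \<exists>z :: 'a \<Rightarrow> 3. (\<forall>u v. {u, v} \<in> E - {e} \<longrightarrow> z u \<noteq> z v) \<and> (\<forall>u\<in>e. \<forall>v\<in>e. z u = z v)"
begin

text \<open>For \<open>e = {a, b}\<close> the value at \<open>a\<close> is
  \<open>2 x a + x b = x b - x a\<close>. So this is the functional
  \<open>z \<mapsto> (x b - x a) (z a - z b)\<close>, written symmetrically in the two ends. The
  built-in sign makes its value at \<open>x\<close> equal to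
  \<open>- (x a - x b) (x a - x b) = -1\<close> for every edge.\<close>

definition \<phi> :: "'a set \<Rightarrow> 'a \<Rightarrow> 3" where
  "\<phi> e w = (if w \<in> e then x w + (\<Sum>v\<in>e. x v) else 0)"

lemma \<phi>_pair:
  assumes "a \<noteq> b"
  shows "\<phi> {a, b} w = (if w = a then x b - x a else if w = b then x a - x b else 0)"
proof -
  have "c + (c + d) = d - c" for c d :: 3
    by (cases c rule: three_cases; cases d rule: three_cases; simp)
  then show ?thesis using assms by (simp add: \<phi>_def add.commute[of "x a" "x b"])
qed

lemma finite_E: "finite E"
proof -
  have "E \<subseteq> Pow V" using edge_subset by blast
  then show ?thesis using finite_verts by (meson finite_Pow_iff finite_subset)
qed

lemma edge_pair:
  assumes "e \<in> E"
  obtains a b where "e = {a, b}" "a \<noteq> b" "a \<in> V" "b \<in> V" "x a \<noteq> x b"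
proof -
  obtain a b where "e = {a, b}" "a \<noteq> b" using edge_card[OF assms] by (auto simp: card_2_iff)
  then show thesis using that[of a b] edge_subset[OF assms] proper[of a b] assms by simp
qed

lemma sum_pair:
  fixes g :: "'a \<Rightarrow> 3"
  assumes "a \<in> V" "b \<in> V" "a \<noteq> b"
  shows "(\<Sum>w\<in>V. \<phi> {a, b} w * g w) = (x b - x a) * g a + (x a - x b) * g b"
proof -
  have "(\<Sum>w\<in>V. \<phi> {a, b} w * g w) = (\<Sum>w\<in>{a, b}. \<phi> {a, b} w * g w)"
    using assms finite_verts by (intro sum.mono_neutral_right) (auto simp: \<phi>_def)
  then show ?thesis using assms(3) by (simp add: \<phi>_pair)
qed

lemma sum_ind:
  fixes g :: "'a \<Rightarrow> 3"
  assumes "T \<subseteq> V"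
  shows "(\<Sum>w\<in>V. ind T w * g w) = sum g T"
proof -
  have "(\<Sum>w\<in>V. ind T w * g w) = (\<Sum>w\<in>T. ind T w * g w)"
    using assms finite_verts by (intro sum.mono_neutral_right) (auto simp: ind_def)
  also have "\<dots> = sum g T" by (rule sum.cong) (simp_all add: ind_def)
  finally show ?thesis .
qed

abbreviation "\<T> \<equiv> triangles E"

lemma triangle_V: "T \<in> \<T> \<Longrightarrow> T \<subseteq> V"
  using triangle_subset[of T E] edge_subset by blast

lemma finite_T: "finite \<T>"
proof -
  have "\<T> \<subseteq> Pow V" using triangle_V by blast
  then show ?thesis using finite_verts by (meson finite_Pow_iff finite_subset)
qed

lemma finite_sub: "K \<subseteq> \<T> \<Longrightarrow> finite K"
  using finite_T finite_subset by blast

lemma triangle_edges: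
  assumes "{a, b, c} \<in> \<T>" "a \<noteq> b" "b \<noteq> c" "a \<noteq> c"
  shows "{e \<in> E. e \<subseteq> {a, b, c}} = {{a, b}, {b, c}, {a, c}}"
proof
  show "{e \<in> E. e \<subseteq> {a, b, c}} \<subseteq> {{a, b}, {b, c}, {a, c}}"
  proof
    fix e assume e: "e \<in> {e \<in> E. e \<subseteq> {a, b, c}}"
    then have "e \<in> E" by simp
    then obtain u v where "e = {u, v}" "u \<noteq> v" by (rule edge_pair)
    then show "e \<in> {{a, b}, {b, c}, {a, c}}" using e by (auto simp: insert_commute)
  qed
  show "{{a, b}, {b, c}, {a, c}} \<subseteq> {e \<in> E. e \<subseteq> {a, b, c}}"
    using triangle_edge[OF assms(1)] assms(2-4) by simp
qed

lemma span_sum_zero: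
  fixes g :: "'a \<Rightarrow> 3"
  assumes "\<psi> \<in> tspan K" "\<And>T. T \<in> K \<Longrightarrow> T \<subseteq> V" "\<And>T. T \<in> K \<Longrightarrow> sum g T = 0"
  shows "(\<Sum>w\<in>V. \<psi> w * g w) = 0"
proof -
  obtain c where c: "\<forall>w. \<psi> w = (\<Sum>T\<in>K. c T * ind T w)" by (rule tspanE[OF assms(1)])
  have "(\<Sum>w\<in>V. \<psi> w * g w) = (\<Sum>w\<in>V. \<Sum>T\<in>K. c T * (ind T w * g w))"
    by (simp add: c sum_distrib_right mult.assoc)
  also have "\<dots> = (\<Sum>T\<in>K. \<Sum>w\<in>V. c T * (ind T w * g w))" by (rule sum.swap)
  also have "\<dots> = (\<Sum>T\<in>K. c T * sum g T)"
    using assms(2) by (intro sum.cong) (simp_all add: sum_distrib_left[symmetric] sum_ind)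
  also have "\<dots> = 0" using assms(3) by (intro sum.neutral) simp
  finally show ?thesis .
qed

text \<open>Pair the difference with the colouring \<open>z\<close> that merges \<open>e\<close>.
  Its sum over each triangle of \<open>K\<close> is zero, as these triangles avoid \<open>e\<close>,
  so it kills \<open>tspan K\<close>. It also kills \<open>\<phi> e\<close>, but not
  \<open>\<phi> f\<close>. Every later use of irredundancy goes through this lemma.\<close>

lemma pair_not_in_span:
  assumes e: "e \<in> E" and f: "f \<in> E" and "e \<noteq> f" and K: "K \<subseteq> \<T>" "\<And>T. T \<in> K \<Longrightarrow> \<not> e \<subseteq> T"
  shows "(\<lambda>w. \<phi> e w - \<phi> f w) \<notin> tspan K"
proof
  assume span: "(\<lambda>w. \<phi> e w - \<phi> f w) \<in> tspan K"
  obtain z :: "'a \<Rightarrow> 3" where z: "\<And>u v. {u, v} \<in> E - {e} \<Longrightarrow> z u \<noteq> z v" "\<And>u v. u \<in> e \<Longrightarrow> v \<in> e \<Longrightarrow> z u = z v"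
    using irredundant[OF e] by metis
  have "sum z T = 0" if T: "T \<in> K" for T
  proof -
    have "T \<in> \<T>" using T K(1) by blast
    then obtain a b c where abc: "T = {a, b, c}" "a \<noteq> b" "b \<noteq> c" "a \<noteq> c" "{a, b} \<in> E" "{b, c} \<in> E" "{a, c} \<in> E"
      by (rule triangle_obtain)
    have "{a, b} \<noteq> e" "{b, c} \<noteq> e" "{a, c} \<noteq> e" using K(2)[OF T] abc(1) by blast+
    then have "z a \<noteq> z b" "z b \<noteq> z c" "z a \<noteq> z c" using z(1) abc by simp_all
    then have "z a + z b + z c = 0" by (rule distinct_sum_zero)
    then show ?thesis using abc by (simp add: add.assoc)
  qed
  then have "(\<Sum>w\<in>V. (\<phi> e w - \<phi> f w) * z w) = 0"
    using span_sum_zero[OF span] triangle_V K(1) by blast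
  then have eq: "(\<Sum>w\<in>V. \<phi> e w * z w) = (\<Sum>w\<in>V. \<phi> f w * z w)"
    by (simp add: left_diff_distrib sum_subtractf)
  obtain a b where ab: "e = {a, b}" "a \<noteq> b" "a \<in> V" "b \<in> V" by (rule edge_pair[OF e])
  obtain c d where cd: "f = {c, d}" "c \<noteq> d" "c \<in> V" "d \<in> V" "x c \<noteq> x d" by (rule edge_pair[OF f])
  have "z a = z b" using z(2) ab(1) by simp
  then have "(\<Sum>w\<in>V. \<phi> e w * z w) = (x b - x a) * z b + (x a - x b) * z b"
    using ab by (simp add: sum_pair)
  then have "(\<Sum>w\<in>V. \<phi> e w * z w) = 0" by (simp add: left_diff_distrib)
  then have "(x d - x c) * z c + (x c - x d) * z d = 0" using eq cd by (simp add: sum_pair)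
  then have "(x d - x c) * (z c - z d) = 0" by (simp add: algebra_simps)
  moreover have "z c \<noteq> z d" using z(1) f cd(1) \<open>e \<noteq> f\<close> by simp
  ultimately show False using cd(5) by (simp add: three_mult_eq_0)
qed

text \<open>Here the sign in \<open>\<phi>\<close> pays off: modulo the equation of a triangle its
  edges become equal, not merely equal up to sign.\<close>

lemma \<phi>_triangle:
  assumes "a \<noteq> b" "b \<noteq> c" "a \<noteq> c" "x a + x b + x c = 0"
  shows "\<phi> {a, c} w = \<phi> {a, b} w + (x c - x b) * ind {a, b, c} w"
proof -
  have xa: "x a = - x b - x c" using assms(4) by (simp add: algebra_simps eq_neg_iff_add_eq_0)
  have 1: "2 * y = - y" "y * 3 = 0" for y :: 3 by (cases y rule: three_cases; simp)+
  show ?thesis using assms(1-3) by (auto simp: \<phi>_pair ind_def xa algebra_simps 1)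
qed

lemma triangle_sum: "{a, b, c} \<in> \<T> \<Longrightarrow> a \<noteq> b \<Longrightarrow> b \<noteq> c \<Longrightarrow> a \<noteq> c \<Longrightarrow> x a + x b + x c = 0"
  using triangle_edge[of "{a, b, c}" E] proper by (intro distinct_sum_zero) auto

text \<open>The three edges of a triangle form a full line in the direction of its indicator.\<close>

lemma triangle_line:
  assumes "{a, b, c} \<in> \<T>" "a \<noteq> b" "b \<noteq> c" "a \<noteq> c"
  obtains g where "g \<in> {{a, b}, {b, c}, {a, c}}" "\<forall>w. \<phi> g w = \<phi> {a, b} w + d * ind {a, b, c} w"
proof -
  have s: "x a + x b + x c = 0" using triangle_sum[OF assms] .
  have n: "x a \<noteq> x b" "x b \<noteq> x c" "x a \<noteq> x c"
    using triangle_edge[OF assms(1)] proper assms(2-4) by simp_all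
  have 1: "\<phi> {a, c} w = \<phi> {a, b} w + (x c - x b) * ind {a, b, c} w" for w
    using \<phi>_triangle[of a b c w] assms s by simp
  have 2: "\<phi> {b, c} w = \<phi> {a, b} w + (x c - x a) * ind {a, b, c} w" for w
    using \<phi>_triangle[of b a c w] assms s by (simp add: insert_commute add.commute)
  have "d = 0 \<or> d = x c - x b \<or> d = x c - x a" using n by (intro three_cover) auto
  then show thesis using that[of "{a, b}"] that[of "{a, c}"] that[of "{b, c}"] 1 2 by auto
qed

section \<open>Strips of triangles glued along edges\<close>

definition ed :: "'a set set \<Rightarrow> 'a set set" where
  "ed K = {e \<in> E. \<exists>T\<in>K. e \<subseteq> T}"

text \<open>The equations of a strip determine a solution on its vertices up to an affine map, which is
  the content of \<open>strip_rigid\<close> in dual form.\<close>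

inductive strip :: "'a set set \<Rightarrow> bool" where
  base: "T \<in> \<T> \<Longrightarrow> strip {T}"
| step: "strip K \<Longrightarrow> T \<in> \<T> \<Longrightarrow> T \<notin> K \<Longrightarrow> e \<in> ed K \<Longrightarrow> e \<subseteq> T \<Longrightarrow> strip (insert T K)"

lemma strip_triangles: "strip K \<Longrightarrow> K \<subseteq> \<T> \<and> K \<noteq> {}"
  by (induction rule: strip.induct) auto

lemma strip_finite: "strip K \<Longrightarrow> finite K"
  using strip_triangles finite_sub by blast

lemma ed_subset: "e \<in> ed K \<Longrightarrow> e \<in> E \<and> e \<subseteq> \<Union>K"
  by (auto simp: ed_def)

lemma ed_insert: "ed (insert T K) = ed K \<union> {e \<in> E. e \<subseteq> T}"
  by (auto simp: ed_def)

lemma triangle_at_edge: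
  assumes "T \<in> \<T>" "e \<in> E" "e \<subseteq> T"
  obtains u v w where "T = {u, v, w}" "e = {u, v}" "u \<noteq> v" "v \<noteq> w" "u \<noteq> w"
proof -
  obtain u v where e: "e = {u, v}" "u \<noteq> v" "u \<in> V" "v \<in> V" "x u \<noteq> x v" by (rule edge_pair[OF assms(2)])
  have "card T = 3" using assms(1) by (simp add: triangles_def)
  then have "card (T - e) = 1" using e assms(3) by (simp add: card_Diff_subset)
  then obtain w where w: "T - e = {w}" by (rule card_1_singletonE)
  then have "T = {u, v, w}" "w \<noteq> u" "w \<noteq> v" using e assms(3) by blast+
  then show thesis using that[of u v w] e by simp
qed

text \<open>Along the gluing, subtracting a multiple of \<open>ind T\<close> removes the new vertex
  \<open>w\<close> from the support. Both sum conditions survive, since \<open>ind T\<close> kills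
  the constants and \<open>x\<close>.\<close>

lemma strip_rigid:
  assumes "strip K" "\<forall>w. w \<notin> \<Union>K \<longrightarrow> \<psi> w = 0" "(\<Sum>w\<in>V. \<psi> w) = 0" "(\<Sum>w\<in>V. \<psi> w * x w) = 0"
  shows "\<psi> \<in> tspan K"
  using assms
proof (induction arbitrary: \<psi> rule: strip.induct)
  case (base T)
  obtain a b c where abc: "T = {a, b, c}" "a \<noteq> b" "b \<noteq> c" "a \<noteq> c" "{a, b} \<in> E" "{b, c} \<in> E" "{a, c} \<in> E"
    by (rule triangle_obtain[OF base.hyps])
  have TV: "T \<subseteq> V" using triangle_V[OF base.hyps] .
  have supp: "\<psi> w = 0" if "w \<notin> T" for w using base.prems(1) that by simp
  have "(\<Sum>w\<in>V. \<psi> w) = (\<Sum>w\<in>T. \<psi> w)" "(\<Sum>w\<in>V. \<psi> w * x w) = (\<Sum>w\<in>T. \<psi> w * x w)"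
    using TV finite_verts supp by (intro sum.mono_neutral_right; simp)+
  then have "\<psi> a + \<psi> b + \<psi> c = 0" "\<psi> a * x a + \<psi> b * x b + \<psi> c * x c = 0"
    using base.prems(2,3) abc by (simp_all add: add.assoc)
  moreover have "x a \<noteq> x b" "x b \<noteq> x c" "x a \<noteq> x c" using proper abc by simp_all
  ultimately have eq: "\<psi> b = \<psi> a" "\<psi> c = \<psi> a"
    using three_dependence by blast+
  show ?case
  proof (rule tspanI[where c = "\<lambda>_. \<psi> a"])
    fix w show "\<psi> w = (\<Sum>T\<in>{T}. \<psi> a * ind T w)"
      using abc(1) eq supp[of w] by (auto simp: ind_def)
  qed
next
  case (step K T e)
  have K: "K \<subseteq> \<T>" "finite K" using strip_triangles[OF step.hyps(1)] strip_finite[OF step.hyps(1)] by simp_all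
  have e: "e \<in> E" "e \<subseteq> \<Union>K" using ed_subset[OF step.hyps(4)] by simp_all
  obtain u v w where T: "T = {u, v, w}" "e = {u, v}" "u \<noteq> v" "v \<noteq> w" "u \<noteq> w"
    by (rule triangle_at_edge[OF step.hyps(2) e(1) step.hyps(5)])
  \<comment> \<open>The coefficient 0 serves a triangle whose third vertex already lies in the
    strip, a case that \<open>new_vertex\<close> excludes only later, with the help of this
    lemma.\<close>
  define \<eta> where "\<eta> = (\<lambda>y. \<psi> y - (if w \<in> \<Union>K then 0 else \<psi> w) * ind T y)"
  have TV: "T \<subseteq> V" using triangle_V[OF step.hyps(2)] .
  have xT: "sum x T = 0" using triangle_sum[of u v w] step.hyps(2) T by (simp add: add.assoc)
  have "(\<Sum>y\<in>V. ind T y) = 0" using sum_ind[OF TV, of "\<lambda>_. 1"] T by simp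
  moreover have "(\<Sum>y\<in>V. ind T y * x y) = 0" using sum_ind[OF TV, of x] xT by simp
  ultimately have s: "(\<Sum>y\<in>V. \<eta> y) = 0" "(\<Sum>y\<in>V. \<eta> y * x y) = 0"
    using step.prems(2,3) unfolding \<eta>_def
    by (simp_all add: sum_subtractf left_diff_distrib sum_distrib_left[symmetric] mult.assoc)
  have "\<forall>y. y \<notin> \<Union>K \<longrightarrow> \<eta> y = 0"
  proof (intro allI impI)
    fix y assume y: "y \<notin> \<Union>K"
    show "\<eta> y = 0"
    proof (cases "y = w")
      case True
      then show ?thesis using y T(1) by (simp add: \<eta>_def ind_def)
    next
      case False
      then have "y \<notin> T" using y e(2) T(1,2) by blast
      then have "\<psi> y = 0" using step.prems(1) y by simp
      then show ?thesis using \<open>y \<notin> T\<close> by (simp add: \<eta>_def ind_def)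
    qed
  qed
  then have "\<eta> \<in> tspan K" using step.IH s by blast
  then have 1: "\<eta> \<in> tspan (insert T K)" using K(2) by (rule tspan_mono[OF _ subset_insertI finite.insertI])
  have "ind T \<in> tspan (insert T K)" using K(2) by (intro tspan_base) simp_all
  from tspan_add[OF 1 tspan_scale[OF this, of "if w \<in> \<Union>K then 0 else \<psi> w"]]
  show ?case by (simp add: \<eta>_def)
qed

lemma sum_\<phi>:
  assumes "e \<in> E"
  shows "(\<Sum>w\<in>V. \<phi> e w) = 0" "(\<Sum>w\<in>V. \<phi> e w * x w) = -1"
proof -
  obtain a b where ab: "e = {a, b}" "a \<noteq> b" "a \<in> V" "b \<in> V" "x a \<noteq> x b" by (rule edge_pair[OF assms])
  show "(\<Sum>w\<in>V. \<phi> e w) = 0" using sum_pair[OF ab(3,4,2), of "\<lambda>_. 1"] ab(1) by simp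
  have "(\<Sum>w\<in>V. \<phi> e w * x w) = - ((x a - x b) * (x a - x b))"
    using sum_pair[OF ab(3,4,2), of x] ab(1) by (simp add: algebra_simps)
  then show "(\<Sum>w\<in>V. \<phi> e w * x w) = -1" using three_square[of "x a - x b"] ab(5) by simp
qed

text \<open>Both functionals kill the constants and take the value -1 at \<open>x\<close>, so their
  difference falls under rigidity. It is the vertices of \<open>e\<close> and \<open>f\<close> that
  lie in the strip: chords are covered too, which \<open>new_vertex\<close> exploits.\<close>

lemma strip_edges_equal:
  assumes "strip K" "e \<in> E" "f \<in> E" "e \<subseteq> \<Union>K" "f \<subseteq> \<Union>K"
  shows "(\<lambda>w. \<phi> e w - \<phi> f w) \<in> tspan K"
proof (rule strip_rigid[OF assms(1)])
  show "\<forall>w. w \<notin> \<Union>K \<longrightarrow> \<phi> e w - \<phi> f w = 0"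
  proof (intro allI impI)
    fix w assume "w \<notin> \<Union>K"
    then have "w \<notin> e" "w \<notin> f" using assms(4,5) by blast+
    then show "\<phi> e w - \<phi> f w = 0" by (simp add: \<phi>_def)
  qed
  show "(\<Sum>w\<in>V. \<phi> e w - \<phi> f w) = 0" using sum_\<phi>(1) assms(2,3) by (simp add: sum_subtractf)
  show "(\<Sum>w\<in>V. (\<phi> e w - \<phi> f w) * x w) = 0"
    using sum_\<phi>(2) assms(2,3) by (simp add: left_diff_distrib sum_subtractf)
qed

definition full :: "'a set set \<Rightarrow> bool" where
  "full K \<longleftrightarrow> (\<forall>T\<in>\<T>. {e \<in> E. e \<subseteq> T} \<subseteq> ed K \<longrightarrow> T \<in> K)"

text \<open>Otherwise all vertices of \<open>T\<close> lie in the strip while, by fullness, some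
  edge \<open>g\<close> of \<open>T\<close> is in no triangle of \<open>K\<close>. As a chord,
  \<open>g\<close> is congruent to \<open>e\<close> modulo \<open>K\<close>, against
  \<open>pair_not_in_span\<close>. Hence each gluing adds one vertex and two edges.\<close>

lemma new_vertex:
  assumes K: "strip K" "full K" and T: "T \<in> \<T>" "T \<notin> K" and e: "e \<in> ed K" "e \<subseteq> T"
  obtains u v w where "T = {u, v, w}" "e = {u, v}" "u \<noteq> v" "v \<noteq> w" "u \<noteq> w" "w \<notin> \<Union>K"
proof -
  have eE: "e \<in> E" and eK: "e \<subseteq> \<Union>K" using ed_subset[OF e(1)] by simp_all
  obtain u v w where uvw: "T = {u, v, w}" "e = {u, v}" "u \<noteq> v" "v \<noteq> w" "u \<noteq> w"
    by (rule triangle_at_edge[OF T(1) eE e(2)])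
  have "w \<notin> \<Union>K"
  proof
    assume "w \<in> \<Union>K"
    then have TK: "T \<subseteq> \<Union>K" using uvw(1,2) eK by blast
    obtain g where g: "g \<in> E" "g \<subseteq> T" "g \<notin> ed K" using K(2) T unfolding full_def by blast
    have "g \<noteq> e" using g(3) e(1) by blast
    moreover have "\<not> g \<subseteq> S" if "S \<in> K" for S using g that by (auto simp: ed_def)
    ultimately have "(\<lambda>w. \<phi> g w - \<phi> e w) \<notin> tspan K"
      using strip_triangles[OF K(1)] by (intro pair_not_in_span[OF g(1) eE]) auto
    moreover have "g \<subseteq> \<Union>K" using g(2) TK by (rule subset_trans)
    ultimately show False using strip_edges_equal[OF K(1) g(1) eE _ eK] by blast
  qed
  then show thesis using that uvw by blast
qed

text \<open>Let all edges of a triangle lie in \<open>ed (insert T K)\<close>. If it contains the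
  new vertex \<open>w\<close>, it is \<open>T\<close>, as \<open>w\<close> lies in no triangle of
  \<open>K\<close>. If not, its edges are in \<open>ed K\<close> already, since \<open>e\<close> is
  the only edge of \<open>T\<close> that avoids \<open>w\<close>.\<close>

lemma strip_full: "strip K \<Longrightarrow> full K"
proof (induction rule: strip.induct)
  case (base T)
  show ?case unfolding full_def
  proof (intro ballI impI)
    fix S assume S: "S \<in> \<T>" "{e \<in> E. e \<subseteq> S} \<subseteq> ed {T}"
    have "S \<subseteq> T"
    proof
      fix y assume y: "y \<in> S"
      obtain a b c where abc: "S = {a, b, c}" "a \<noteq> b" "b \<noteq> c" "a \<noteq> c" "{a, b} \<in> E" "{b, c} \<in> E" "{a, c} \<in> E"
        by (rule triangle_obtain[OF S(1)])
      then have "{a, b} \<in> ed {T}" "{b, c} \<in> ed {T}" using S(2) by blast+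
      then show "y \<in> T" using abc(1) y by (auto simp: ed_def)
    qed
    moreover have "finite T" "card S = card T"
      using base S(1) triangle_V[OF base] finite_verts finite_subset by (auto simp: triangles_def)
    ultimately show "S \<in> {T}" using card_subset_eq[of T S] by simp
  qed
next
  case (step K T e)
  obtain u v w where T: "T = {u, v, w}" "e = {u, v}" "u \<noteq> v" "v \<noteq> w" "u \<noteq> w" and w: "w \<notin> \<Union>K"
    by (rule new_vertex[OF step.hyps(1) step.IH step.hyps(2-5)])
  show ?case unfolding full_def
  proof (intro ballI impI)
    fix S assume S: "S \<in> \<T>" "{e \<in> E. e \<subseteq> S} \<subseteq> ed (insert T K)"
    show "S \<in> insert T K"
    proof (cases "w \<in> S")
      case False
      have "{g \<in> E. g \<subseteq> S} \<subseteq> ed K"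
      proof
        fix g assume g: "g \<in> {g \<in> E. g \<subseteq> S}"
        then have "g \<in> ed K \<or> g \<subseteq> T" using S(2) by (auto simp: ed_insert)
        then show "g \<in> ed K"
        proof
          assume gT: "g \<subseteq> T"
          have "w \<notin> g" using g False by blast
          then have "g \<subseteq> e" using gT T(1,2) by blast
          moreover have "card g = 2" "card e = 2" using edge_card g ed_subset[OF step.hyps(4)] by simp_all
          moreover have "finite e" using T(2) by simp
          ultimately have "g = e" using card_subset_eq[of e g] by simp
          then show ?thesis using step.hyps(4) by simp
        qed
      qed
      then show ?thesis using step.IH S(1) unfolding full_def by blast
    next
      case True
      have "S \<subseteq> T"
      proof
        fix y assume y: "y \<in> S"
        show "y \<in> T"
        proof (cases "y = w")
          case False
          then have "{w, y} \<in> E" using triangle_edge[OF S(1) True y] by simp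
          then have "{w, y} \<in> ed (insert T K)" using S(2) True y by blast
          then show ?thesis using w by (auto simp: ed_def)
        qed (use T(1) in simp)
      qed
      moreover have "card S = card T" using S(1) step.hyps(2) by (simp add: triangles_def)
      moreover have "finite T" using T(1) by simp
      ultimately show ?thesis using card_subset_eq[of T S] by simp
    qed
  qed
qed

lemma strip_card: "strip K \<Longrightarrow> card (ed K) = 2 * card K + 1"
proof (induction rule: strip.induct)
  case (base T)
  obtain a b c where abc: "T = {a, b, c}" "a \<noteq> b" "b \<noteq> c" "a \<noteq> c" "{a, b} \<in> E" "{b, c} \<in> E" "{a, c} \<in> E"
    by (rule triangle_obtain[OF base])
  have "ed {T} = {{a, b}, {b, c}, {a, c}}"
    using triangle_edges[of a b c] abc base by (simp add: ed_def)
  then show ?case using abc(2-4) by (simp add: doubleton_eq_iff)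
next
  case (step K T e)
  obtain u v w where T: "T = {u, v, w}" "e = {u, v}" "u \<noteq> v" "v \<noteq> w" "u \<noteq> w" and w: "w \<notin> \<Union>K"
    by (rule new_vertex[OF step.hyps(1) strip_full[OF step.hyps(1)] step.hyps(2-5)])
  have "ed (insert T K) = ed K \<union> {{u, v}, {v, w}, {u, w}}"
    using triangle_edges[of u v w] T step.hyps(2) by (simp add: ed_insert)
  then have eq: "ed (insert T K) = insert {v, w} (insert {u, w} (ed K))" using step.hyps(4) T(2) by auto
  have "{v, w} \<notin> ed K" "{u, w} \<notin> ed K" using w by (auto simp: ed_def)
  moreover have "{v, w} \<noteq> {u, w}" using T by (simp add: doubleton_eq_iff)
  moreover have "finite (ed K)" using finite_E by (simp add: ed_def)
  moreover have "card (insert T K) = card K + 1"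
    using step.hyps(3) strip_finite[OF step.hyps(1)] by simp
  ultimately show ?case using step.IH unfolding eq by simp
qed

section \<open>Strips against the remaining triangles: separation and independence\<close>

definition edge_separated :: "'a set set \<Rightarrow> 'a set set \<Rightarrow> bool" where
  "edge_separated S K \<longleftrightarrow> S \<subseteq> \<T> \<and> (\<forall>T\<in>S. \<forall>e\<in>E. e \<subseteq> T \<longrightarrow> e \<notin> ed K)"

lemma edge_separated_insert: "edge_separated S (insert T K) \<Longrightarrow> edge_separated S K"
  unfolding edge_separated_def ed_def by blast

lemma edge_separatedD: "edge_separated S K \<Longrightarrow> T \<in> S \<Longrightarrow> e \<in> ed K \<Longrightarrow> \<not> e \<subseteq> T"
  unfolding edge_separated_def using ed_subset[of e K] by blast

text \<open>Provides the two edges at the new vertex \<open>w\<close>, which no triangle of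
  \<open>K\<close> or \<open>S\<close> contains; to them \<open>pair_not_in_span\<close>
  applies.\<close>

lemma strip_step_cases:
  assumes "strip K" "T \<in> \<T>" "T \<notin> K" "e \<in> ed K" "e \<subseteq> T" "edge_separated S (insert T K)"
  obtains u v w where "T = {u, v, w}" "e = {u, v}" "u \<noteq> v" "v \<noteq> w" "u \<noteq> w" "T \<notin> K \<union> S"
    "{u, w} \<in> E" "{v, w} \<in> E" "{u, w} \<in> ed (insert T K)" "{v, w} \<in> ed (insert T K)"
    "\<forall>U\<in>K \<union> S. \<not> {u, w} \<subseteq> U" "\<forall>U\<in>K \<union> S. \<not> {v, w} \<subseteq> U"
proof -
  obtain u v w where T: "T = {u, v, w}" "e = {u, v}" "u \<noteq> v" "v \<noteq> w" "u \<noteq> w" and w: "w \<notin> \<Union>K"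
    by (rule new_vertex[OF assms(1) strip_full[OF assms(1)] assms(2-5)])
  have E: "{u, w} \<in> E" "{v, w} \<in> E" using triangle_edge[OF assms(2)] T by simp_all
  have ed: "{u, w} \<in> ed (insert T K)" "{v, w} \<in> ed (insert T K)"
    using E T(1) by (simp_all add: ed_insert)
  have S: "\<not> {u, w} \<subseteq> U" "\<not> {v, w} \<subseteq> U" if "U \<in> K \<union> S" for U
  proof (atomize (full), cases "U \<in> K")
    case True
    then show "\<not> {u, w} \<subseteq> U \<and> \<not> {v, w} \<subseteq> U" using w by blast
  next
    case False
    then have "U \<in> S" using that by simp
    then show "\<not> {u, w} \<subseteq> U \<and> \<not> {v, w} \<subseteq> U"
      using edge_separatedD[OF assms(6) _ ed(1)] edge_separatedD[OF assms(6) _ ed(2)] by blast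
  qed
  moreover have "T \<notin> K \<union> S" using S(1)[of T] T(1) by blast
  ultimately show thesis using that[OF T _ E ed] by blast
qed

lemma span_swap:
  assumes "(\<lambda>w. \<psi> w - \<eta> w) \<in> tspan K"
  shows "(\<lambda>w. \<eta> w - \<psi> w) \<in> tspan K"
  using tspan_scale[OF assms, of "-1"] by simp

text \<open>A congruence modulo \<open>K \<union> S\<close> is freed of the last triangle
  \<open>T\<close> by \<open>triangle_line\<close>: the multiple of \<open>ind T\<close> in it is
  absorbed by passing to another edge \<open>g\<close> of \<open>T\<close>. Then \<open>g\<close> is
  either the gluing edge, which the induction excludes, or an edge in no remaining triangle, which
  \<open>pair_not_in_span\<close> excludes.\<close>

lemma strip_separates:
  assumes "strip K" "edge_separated S K" "f \<in> E" "f \<notin> ed K" "e \<in> ed K"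
  shows "(\<lambda>w. \<phi> f w - \<phi> e w) \<notin> tspan (K \<union> S)"
  using assms
proof (induction arbitrary: e rule: strip.induct)
  case (base T)
  have S: "S \<subseteq> \<T>" "finite S" using base.prems(1) finite_sub by (simp_all add: edge_separated_def)
  have TS: "T \<notin> S" using edge_separatedD[OF base.prems(1) _ base.prems(4)] base.prems(4) by (auto simp: ed_def)
  have e: "e \<in> E" "e \<subseteq> T" using base.prems(4) by (auto simp: ed_def)
  obtain u v w where T: "T = {u, v, w}" "e = {u, v}" "u \<noteq> v" "v \<noteq> w" "u \<noteq> w"
    by (rule triangle_at_edge[OF base.hyps e])
  show ?case
  proof
    assume "(\<lambda>y. \<phi> f y - \<phi> e y) \<in> tspan ({T} \<union> S)"
    then have "(\<lambda>y. \<phi> f y - \<phi> e y) \<in> tspan (insert T S)" by simp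
    then obtain d \<sigma> where \<sigma>: "\<sigma> \<in> tspan S" "\<forall>y. \<phi> f y - \<phi> e y = d * ind T y + \<sigma> y"
      by (rule tspan_insert[OF _ TS S(2)])
    obtain g where g: "g \<in> {{u, v}, {v, w}, {u, w}}" "\<forall>y. \<phi> g y = \<phi> {u, v} y + d * ind {u, v, w} y"
      by (rule triangle_line[of u v w d]) (use base.hyps T in simp_all)
    have gE: "g \<in> E" "g \<subseteq> T" using g(1) triangle_edges[of u v w] T base.hyps by auto
    then have ged: "g \<in> ed {T}" by (simp add: ed_def)
    have "\<phi> f y - \<phi> g y = \<sigma> y" for y
      using \<sigma>(2)[rule_format, of y] g(2)[rule_format, of y] T(1,2) by (simp add: algebra_simps)
    then have "(\<lambda>y. \<phi> f y - \<phi> g y) \<in> tspan S" using \<sigma>(1) by simp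
    then have "(\<lambda>y. \<phi> g y - \<phi> f y) \<in> tspan S" by (rule span_swap)
    moreover have "g \<noteq> f" using ged base.prems(3) by blast
    ultimately show False
      using pair_not_in_span[OF gE(1) base.prems(2) _ S(1)] edge_separatedD[OF base.prems(1) _ ged] by blast
  qed
next
  case (step K T e0)
  have S: "S \<subseteq> \<T>" using step.prems(1) by (simp add: edge_separated_def)
  have K: "K \<subseteq> \<T>" using strip_triangles[OF step.hyps(1)] by simp
  have KS: "K \<union> S \<subseteq> \<T>" "finite (K \<union> S)" using K S finite_sub by simp_all
  obtain u v w where T: "T = {u, v, w}" "e0 = {u, v}" "u \<noteq> v" "v \<noteq> w" "u \<noteq> w" and TKS: "T \<notin> K \<union> S"
    and E: "{u, w} \<in> E" "{v, w} \<in> E" "{u, w} \<in> ed (insert T K)" "{v, w} \<in> ed (insert T K)"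
    and new: "\<forall>U\<in>K \<union> S. \<not> {u, w} \<subseteq> U" "\<forall>U\<in>K \<union> S. \<not> {v, w} \<subseteq> U"
    by (rule strip_step_cases[OF step.hyps step.prems(1)])
  have f0: "f \<notin> ed K" using step.prems(3) by (simp add: ed_insert)
  have IH: "(\<lambda>y. \<phi> f y - \<phi> e0 y) \<notin> tspan (K \<union> S)"
    by (rule step.IH[OF edge_separated_insert[OF step.prems(1)] step.prems(2) f0 step.hyps(4)])
  have e0: "e0 \<in> E" "e0 \<subseteq> \<Union>(insert T K)" using ed_subset[OF step.hyps(4)] by auto
  have e: "e \<in> E" "e \<subseteq> \<Union>(insert T K)" using ed_subset[OF step.prems(4)] by simp_all
  show ?case
  proof
    assume span: "(\<lambda>y. \<phi> f y - \<phi> e y) \<in> tspan (insert T K \<union> S)"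
    have "(\<lambda>y. \<phi> e y - \<phi> e0 y) \<in> tspan (insert T K)"
      by (rule strip_edges_equal[OF strip.step[OF step.hyps] e(1) e0(1) e(2) e0(2)])
    then have "(\<lambda>y. \<phi> e y - \<phi> e0 y) \<in> tspan (insert T K \<union> S)"
      using KS(2) by (intro tspan_mono[of _ "insert T K" "insert T K \<union> S"]) auto
    from tspan_add[OF span this] have "(\<lambda>y. \<phi> f y - \<phi> e0 y) \<in> tspan (insert T (K \<union> S))" by simp
    then obtain d \<sigma> where \<sigma>: "\<sigma> \<in> tspan (K \<union> S)" "\<forall>y. \<phi> f y - \<phi> e0 y = d * ind T y + \<sigma> y"
      by (rule tspan_insert[OF _ TKS KS(2)])
    obtain g where g: "g \<in> {{u, v}, {v, w}, {u, w}}" "\<forall>y. \<phi> g y = \<phi> {u, v} y + d * ind {u, v, w} y"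
      by (rule triangle_line[of u v w d]) (use step.hyps(2) T in simp_all)
    have "\<phi> f y - \<phi> g y = \<sigma> y" for y
      using \<sigma>(2)[rule_format, of y] g(2)[rule_format, of y] T(1,2) by (simp add: algebra_simps)
    then have fg: "(\<lambda>y. \<phi> f y - \<phi> g y) \<in> tspan (K \<union> S)" using \<sigma>(1) by simp
    then have gf: "(\<lambda>y. \<phi> g y - \<phi> f y) \<in> tspan (K \<union> S)" by (rule span_swap)
    have "g \<noteq> e0" using fg IH by blast
    then have "g = {v, w} \<or> g = {u, w}" using g(1) T(2) by blast
    then show False
    proof
      assume gg: "g = {v, w}"
      have "{v, w} \<noteq> f" using E(4) step.prems(3) by blast
      from pair_not_in_span[OF E(2) step.prems(2) this KS(1) new(2)[rule_format]] show False using gf gg by blast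
    next
      assume gg: "g = {u, w}"
      have "{u, w} \<noteq> f" using E(3) step.prems(3) by blast
      from pair_not_in_span[OF E(1) step.prems(2) this KS(1) new(1)[rule_format]] show False using gf gg by blast
    qed
  qed
qed

text \<open>The difference of \<open>\<phi> {u, w}\<close> and \<open>\<phi> {u, v}\<close> is a
  multiple of this indicator, so one edge that the triangles of \<open>K\<close> avoid is
  enough.\<close>

lemma triangle_ind_not_in_span:
  assumes "{u, v, w} \<in> \<T>" "u \<noteq> v" "v \<noteq> w" "u \<noteq> w" "K \<subseteq> \<T>" "\<And>U. U \<in> K \<Longrightarrow> \<not> {u, w} \<subseteq> U"
  shows "ind {u, v, w} \<notin> tspan K"
proof
  assume span: "ind {u, v, w} \<in> tspan K"
  have E: "{u, w} \<in> E" "{u, v} \<in> E" using triangle_edge[OF assms(1)] assms(2-4) by simp_all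
  have s: "x u + x v + x w = 0" using triangle_sum[OF assms(1-4)] .
  have "\<phi> {u, w} y - \<phi> {u, v} y = (x w - x v) * ind {u, v, w} y" for y
    using \<phi>_triangle[OF assms(2-4) s, of y] by simp
  then have "(\<lambda>y. \<phi> {u, w} y - \<phi> {u, v} y) \<in> tspan K" using tspan_scale[OF span, of "x w - x v"] by simp
  moreover have "{u, w} \<noteq> {u, v}" using assms(2-4) by (simp add: doubleton_eq_iff)
  ultimately show False using pair_not_in_span[OF E _ assms(5,6)] by blast
qed

lemma coefficient_zero:
  assumes "ind T \<notin> tspan K" "T \<notin> K" "finite K" "\<forall>y. (\<Sum>U\<in>insert T K. c U * ind U y) = 0"
  shows "c T = 0"
proof (rule ccontr)
  assume c: "c T \<noteq> 0"
  have "ind T y = (\<Sum>U\<in>K. (- c T * c U) * ind U y)" for y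
  proof -
    have "c T * ind T y + (\<Sum>U\<in>K. c U * ind U y) = 0" using assms(2-4) by simp
    then have "c T * (c T * ind T y + (\<Sum>U\<in>K. c U * ind U y)) = 0" by simp
    then have "(c T * c T) * ind T y + (\<Sum>U\<in>K. (c T * c U) * ind U y) = 0"
      by (simp add: distrib_left sum_distrib_left mult.assoc)
    then have "ind T y = - (\<Sum>U\<in>K. (c T * c U) * ind U y)"
      using three_square[OF c] by (simp add: eq_neg_iff_add_eq_0)
    then show ?thesis by (simp add: sum_negf)
  qed
  then have "ind T \<in> tspan K" by (rule tspanI)
  then show False using assms(1) by simp
qed

text \<open>Triangles are peeled off in the reverse order of gluing. The last one has an edge in no
  other triangle of the relation, so its coefficient vanishes.\<close>

lemma strip_independent:
  assumes "strip K" "edge_separated S K" "\<forall>y. (\<Sum>U\<in>K \<union> S. c U * ind U y) = 0" "U \<in> K"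
  shows "c U = 0"
  using assms
proof (induction rule: strip.induct)
  case (base T)
  have S: "S \<subseteq> \<T>" "finite S" using base.prems(1) finite_sub by (simp_all add: edge_separated_def)
  obtain u v w where T: "T = {u, v, w}" "u \<noteq> v" "v \<noteq> w" "u \<noteq> w" "{u, v} \<in> E" "{v, w} \<in> E" "{u, w} \<in> E"
    by (rule triangle_obtain[OF base.hyps])
  have "{u, w} \<in> ed {T}" using T by (simp add: ed_def)
  note sep = edge_separatedD[OF base.prems(1) _ this]
  have "ind T \<notin> tspan S"
    using triangle_ind_not_in_span[of u v w S] base.hyps T(1-4) S(1) sep by simp
  moreover have "T \<notin> S" using sep[of T] T(1) by blast
  ultimately have "c T = 0" using coefficient_zero[of T S c] S(2) base.prems(2) by simp
  then show ?case using base.prems(3) by simp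
next
  case (step K T e)
  have S: "S \<subseteq> \<T>" using step.prems(1) by (simp add: edge_separated_def)
  have K: "K \<subseteq> \<T>" using strip_triangles[OF step.hyps(1)] by simp
  have KS: "K \<union> S \<subseteq> \<T>" "finite (K \<union> S)" using K S finite_sub by simp_all
  obtain u v w where T: "T = {u, v, w}" "e = {u, v}" "u \<noteq> v" "v \<noteq> w" "u \<noteq> w" and TKS: "T \<notin> K \<union> S"
    and E: "{u, w} \<in> E" "{v, w} \<in> E" "{u, w} \<in> ed (insert T K)" "{v, w} \<in> ed (insert T K)"
    and new: "\<forall>U\<in>K \<union> S. \<not> {u, w} \<subseteq> U" "\<forall>U\<in>K \<union> S. \<not> {v, w} \<subseteq> U"
    by (rule strip_step_cases[OF step.hyps step.prems(1)])
  have "ind {u, v, w} \<notin> tspan (K \<union> S)"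
    using step.hyps(2) T(1) by (intro triangle_ind_not_in_span[OF _ T(3-5) KS(1) new(1)[rule_format]]) simp_all
  then have cT: "c T = 0"
    using coefficient_zero[OF _ TKS KS(2), of c] step.prems(2) T(1) by simp
  have "\<forall>y. (\<Sum>U\<in>K \<union> S. c U * ind U y) = 0" using step.prems(2) cT TKS KS(2) by simp
  then have "U \<in> K \<Longrightarrow> c U = 0" using step.IH[OF edge_separated_insert[OF step.prems(1)]] by blast
  then show ?case using cT step.prems(3) by blast
qed

text \<open>A triangle sharing an edge with a strip that is maximal by inclusion could be glued on,
  so it already belongs to it.\<close>

lemma maximal_strip:
  assumes "T \<in> \<T>"
  obtains M where "strip M" "T \<in> M" "edge_separated (\<T> - M) M"
proof -
  let ?A = "{M. strip M \<and> T \<in> M}"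
  have "?A \<subseteq> Pow \<T>" using strip_triangles by blast
  then have fin: "finite ?A" using finite_T by (meson finite_Pow_iff finite_subset)
  have "{T} \<in> ?A" using strip.base[OF assms] by simp
  then obtain M where M: "M \<in> ?A" "\<forall>L\<in>?A. M \<subseteq> L \<longrightarrow> M = L"
    using finite_has_maximal[OF fin] by blast
  have "edge_separated (\<T> - M) M" unfolding edge_separated_def
  proof (intro conjI ballI impI)
    fix S e assume S: "S \<in> \<T> - M" and e: "e \<in> E" "e \<subseteq> S"
    show "e \<notin> ed M"
    proof
      assume "e \<in> ed M"
      then have "strip (insert S M)" using strip.step[of M S e] M(1) S e(2) by simp
      then have "M = insert S M" using M by (intro M(2)[rule_format]) auto
      then show False using S by blast
    qed
  qed simp
  then show thesis using that M(1) by blast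
qed

lemma triangles_independent:
  assumes "\<forall>y. (\<Sum>U\<in>\<T>. c U * ind U y) = 0" "T \<in> \<T>"
  shows "c T = 0"
proof -
  obtain M where M: "strip M" "T \<in> M" "edge_separated (\<T> - M) M" by (rule maximal_strip[OF assms(2)])
  have "M \<union> (\<T> - M) = \<T>" using strip_triangles[OF M(1)] by blast
  then show ?thesis using strip_independent[OF M(1,3) _ M(2), of c] assms(1) by simp
qed

end

section \<open>Classes of congruent edges and their number\<close>

context irredundant_graph
begin

definition erel :: "('a set \<times> 'a set) set" where
  "erel = {(e, f). e \<in> E \<and> f \<in> E \<and> (\<lambda>w. \<phi> e w - \<phi> f w) \<in> tspan \<T>}"

lemma equiv_erel: "equiv E erel"
proof (rule equivI)
  show "erel \<subseteq> E \<times> E" by (auto simp: erel_def)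
  show "refl_on E erel" using tspan_zero by (auto simp: erel_def refl_on_def)
  show "sym erel" using span_swap by (auto simp: erel_def sym_def)
  show "trans erel"
  proof (rule transI)
    fix e f g assume ef: "(e, f) \<in> erel" and fg: "(f, g) \<in> erel"
    then have "(\<lambda>w. (\<phi> e w - \<phi> f w) + (\<phi> f w - \<phi> g w)) \<in> tspan \<T>"
      by (intro tspan_add) (simp_all add: erel_def)
    then show "(e, g) \<in> erel" using ef fg by (simp add: erel_def)
  qed
qed

lemma strip_related:
  assumes "strip K" "e \<in> E" "f \<in> E" "e \<subseteq> \<Union>K" "f \<subseteq> \<Union>K"
  shows "(e, f) \<in> erel"
  using tspan_mono[OF strip_edges_equal[OF assms] _ finite_T] strip_triangles[OF assms(1)] assms(2,3)
  by (simp add: erel_def)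

definition class_triangles :: "'a set set \<Rightarrow> 'a set set" where
  "class_triangles X = {T \<in> \<T>. \<exists>e\<in>X. e \<subseteq> T}"

text \<open>The class of an edge in some triangle is the edge set of a maximal strip: rigidity puts
  these edges into the class, and \<open>strip_separates\<close> keeps all others out. An edge in no
  triangle is alone in its class, the case of 0 triangles.\<close>

lemma class_card:
  assumes "X \<in> E // erel"
  shows "card X = 2 * card (class_triangles X) + 1"
proof -
  obtain e where e: "e \<in> E" and X: "X = erel `` {e}" using assms by (rule quotientE)
  show ?thesis
  proof (cases "\<exists>T\<in>\<T>. e \<subseteq> T")
    case True
    then obtain T where T: "T \<in> \<T>" "e \<subseteq> T" by blast
    obtain M where M: "strip M" "T \<in> M" "edge_separated (\<T> - M) M" by (rule maximal_strip[OF T(1)])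
    have un: "M \<union> (\<T> - M) = \<T>" using strip_triangles[OF M(1)] by blast
    have ed: "e \<in> ed M" using e T(2) M(2) by (auto simp: ed_def)
    have "X = ed M"
    proof
      show "ed M \<subseteq> X"
      proof
        fix f assume "f \<in> ed M"
        then have "(e, f) \<in> erel" using ed_subset[of f M] ed_subset[OF ed] by (intro strip_related[OF M(1)]) simp_all
        then show "f \<in> X" using X by simp
      qed
      show "X \<subseteq> ed M"
      proof
        fix f assume "f \<in> X"
        then have f: "f \<in> E" and ef: "(\<lambda>w. \<phi> e w - \<phi> f w) \<in> tspan \<T>" using X by (simp_all add: erel_def)
        show "f \<in> ed M"
        proof (rule ccontr)
          assume "f \<notin> ed M"
          from strip_separates[OF M(1,3) f this ed] show False using span_swap[OF ef] un by simp
        qed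
      qed
    qed
    moreover have "class_triangles (ed M) = M"
    proof
      show "class_triangles (ed M) \<subseteq> M"
      proof
        fix S assume "S \<in> class_triangles (ed M)"
        then obtain g where g: "S \<in> \<T>" "g \<in> ed M" "g \<subseteq> S" by (auto simp: class_triangles_def)
        show "S \<in> M"
        proof (rule ccontr)
          assume "S \<notin> M"
          then have "S \<in> \<T> - M" using g(1) by simp
          from edge_separatedD[OF M(3) this g(2)] show False using g(3) by simp
        qed
      qed
      show "M \<subseteq> class_triangles (ed M)"
      proof
        fix S assume S: "S \<in> M"
        then have ST: "S \<in> \<T>" using un by blast
        then obtain a b c where abc: "S = {a, b, c}" "a \<noteq> b" "b \<noteq> c" "a \<noteq> c" "{a, b} \<in> E" "{b, c} \<in> E" "{a, c} \<in> E"
          by (rule triangle_obtain)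
        then have "{a, b} \<in> ed M" "{a, b} \<subseteq> S" using S by (auto simp: ed_def)
        then show "S \<in> class_triangles (ed M)" using ST unfolding class_triangles_def by blast
      qed
    qed
    ultimately show ?thesis using strip_card[OF M(1)] by simp
  next
    case False
    have "X = {e}"
    proof
      show "{e} \<subseteq> X" using equiv_class_self[OF equiv_erel e] X by simp
      show "X \<subseteq> {e}"
      proof
        fix f assume "f \<in> X"
        then have f: "f \<in> E" "(\<lambda>w. \<phi> e w - \<phi> f w) \<in> tspan \<T>" using X by (simp_all add: erel_def)
        then show "f \<in> {e}" using pair_not_in_span[OF e f(1) _ subset_refl] False by blast
      qed
    qed
    moreover have "class_triangles {e} = {}" using False by (auto simp: class_triangles_def)
    ultimately show ?thesis by simp
  qed
qed

text \<open>The sum of \<open>2k + 1\<close> over the classes. Each triangle is counted once, since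
  its own edges are congruent and lie in a single class.\<close>

lemma edge_card_classes: "card E = 2 * card \<T> + card (E // erel)"
proof -
  have finQ: "finite (E // erel)" using finite_quotient[OF finite_E] equiv_erel
    by (simp add: finite_E finite_quotient equiv_type)
  have finX: "finite X" if "X \<in> E // erel" for X
    using that finite_E in_quotient_imp_subset[OF equiv_erel that] finite_subset by blast
  have "card E = card (\<Union>(E // erel))" using Union_quotient[OF equiv_erel] by simp
  also have "\<dots> = (\<Sum>X\<in>E // erel. card X)"
    using finX quotient_disj[OF equiv_erel]
    by (intro card_Union_disjoint) (auto simp: pairwise_def disjnt_def)
  also have "\<dots> = (\<Sum>X\<in>E // erel. 2 * card (class_triangles X) + 1)"
    by (rule sum.cong) (simp_all add: class_card)
  also have "\<dots> = 2 * (\<Sum>X\<in>E // erel. card (class_triangles X)) + card (E // erel)"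
    by (simp only: sum.distrib sum_distrib_left sum_constant) simp
  also have "(\<Sum>X\<in>E // erel. card (class_triangles X)) = card (\<Union>X\<in>E // erel. class_triangles X)"
  proof (rule card_UN_disjoint[symmetric, OF finQ])
    show "\<forall>X\<in>E // erel. finite (class_triangles X)" using finite_T by (simp add: class_triangles_def)
    show "\<forall>X\<in>E // erel. \<forall>Y\<in>E // erel. X \<noteq> Y \<longrightarrow> class_triangles X \<inter> class_triangles Y = {}"
    proof (intro ballI impI)
      fix X Y assume XY: "X \<in> E // erel" "Y \<in> E // erel" "X \<noteq> Y"
      show "class_triangles X \<inter> class_triangles Y = {}"
      proof (rule equals0I)
        fix T assume "T \<in> class_triangles X \<inter> class_triangles Y"
        then obtain e f where T: "T \<in> \<T>" and e: "e \<in> X" "e \<subseteq> T" and f: "f \<in> Y" "f \<subseteq> T"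
          unfolding class_triangles_def by blast
        have "e \<in> E" "f \<in> E" using in_quotient_imp_subset[OF equiv_erel] XY e(1) f(1) by blast+
        then have "(e, f) \<in> erel" using e(2) f(2) by (intro strip_related[OF strip.base[OF T]]) simp_all
        then have "X = Y" using quotient_eqI[OF equiv_erel XY(1,2) e(1) f(1)] by simp
        then show False using XY(3) by simp
      qed
    qed
  qed
  also have "(\<Union>X\<in>E // erel. class_triangles X) = \<T>"
  proof
    show "\<T> \<subseteq> (\<Union>X\<in>E // erel. class_triangles X)"
    proof
      fix T assume T: "T \<in> \<T>"
      then obtain a b c where abc: "T = {a, b, c}" "a \<noteq> b" "b \<noteq> c" "a \<noteq> c" "{a, b} \<in> E" "{b, c} \<in> E" "{a, c} \<in> E"
        by (rule triangle_obtain)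
      have "{a, b} \<in> \<Union>(E // erel)" using Union_quotient[OF equiv_erel] abc(5) by simp
      then obtain X where "X \<in> E // erel" "{a, b} \<in> X" by blast
      moreover have "{a, b} \<subseteq> T" using abc(1) by simp
      ultimately show "T \<in> (\<Union>X\<in>E // erel. class_triangles X)" using T unfolding class_triangles_def by blast
    qed
  qed (auto simp: class_triangles_def)
  finally show ?thesis .
qed

text \<open>Adding all combinations of indicators to one functional per class yields pairwise
  distinct functions, as classes differ modulo the span and the triangles are independent. All these
  functions have sum 0 and value -1 at \<open>x\<close>. They are therefore determined by their
  values off the ends of one edge, which leaves \<open>3 ^ (card V - 2)\<close>
  possibilities.\<close>

lemma class_count:
  assumes "E \<noteq> {}"
  shows "card (E // erel) * 3 ^ card \<T> \<le> 3 ^ (card V - 2)"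
proof -
  obtain e0 where "e0 \<in> E" using assms by blast
  then obtain a b where ab: "e0 = {a, b}" "a \<noteq> b" "a \<in> V" "b \<in> V" "x a \<noteq> x b" by (rule edge_pair)
  define r where "r X = (SOME e. e \<in> X)" for X :: "'a set set"
  have r: "r X \<in> X" "r X \<in> E" if X: "X \<in> E // erel" for X
  proof -
    have "X \<noteq> {}" by (rule in_quotient_imp_non_empty[OF equiv_erel X])
    then show "r X \<in> X" unfolding r_def by (simp add: some_in_eq)
    then show "r X \<in> E" using in_quotient_imp_subset[OF equiv_erel X] by blast
  qed
  let ?D = "V - {a, b}"
  let ?A = "(E // erel) \<times> (\<T> \<rightarrow>\<^sub>E (UNIV :: 3 set))"
  let ?B = "?D \<rightarrow>\<^sub>E (UNIV :: 3 set)"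
  define h where "h = (\<lambda>(X, c). restrict (\<lambda>w. \<phi> (r X) w + (\<Sum>T\<in>\<T>. c T * ind T w)) ?D)"
  have "inj_on h ?A"
  proof (rule inj_onI, clarify)
    fix X c Y d
    assume X: "X \<in> E // erel" and Y: "Y \<in> E // erel"
      and c: "c \<in> \<T> \<rightarrow>\<^sub>E (UNIV :: 3 set)" and d: "d \<in> \<T> \<rightarrow>\<^sub>E (UNIV :: 3 set)" and eq: "h (X, c) = h (Y, d)"
    define \<sigma> where "\<sigma> w = (\<Sum>T\<in>\<T>. (c T - d T) * ind T w)" for w
    define \<delta> where "\<delta> w = \<phi> (r X) w - \<phi> (r Y) w + \<sigma> w" for w
    have \<sigma>: "\<sigma> \<in> tspan \<T>" unfolding \<sigma>_def by (rule tspanI) simp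
    have off: "\<delta> w = 0" if "w \<in> ?D" for w
    proof -
      have "h (X, c) w = h (Y, d) w" using eq by simp
      then show ?thesis using that
        by (simp add: h_def \<delta>_def \<sigma>_def left_diff_distrib sum_subtractf algebra_simps)
    qed
    have sx: "sum x T = 0" if T: "T \<in> \<T>" for T
    proof -
      obtain a b c where "T = {a, b, c}" "a \<noteq> b" "b \<noteq> c" "a \<noteq> c" "{a, b} \<in> E" "{b, c} \<in> E" "{a, c} \<in> E"
        by (rule triangle_obtain[OF T])
      then show ?thesis using triangle_sum[of a b c] T by (simp add: add.assoc)
    qed
    have s1: "(\<Sum>y\<in>T. 1 :: 3) = 0" if T: "T \<in> \<T>" for T
      using T by (simp add: triangles_def)
    \<comment> \<open>For the difference \<open>\<delta>\<close> both conditions are homogeneous and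
      involve only its values at \<open>a\<close> and \<open>b\<close>; the system is regular
      because \<open>x a \<noteq> x b\<close>.\<close>
    have "(\<Sum>w\<in>V. \<sigma> w * 1) = 0" by (rule span_sum_zero[OF \<sigma> triangle_V s1])
    then have "(\<Sum>w\<in>V. \<delta> w) = 0"
      using sum_\<phi>(1)[OF r(2)[OF X]] sum_\<phi>(1)[OF r(2)[OF Y]] by (simp add: \<delta>_def sum.distrib sum_subtractf)
    moreover have "(\<Sum>w\<in>V. \<delta> w) = (\<Sum>w\<in>{a, b}. \<delta> w)"
      using ab off finite_verts by (intro sum.mono_neutral_right) auto
    ultimately have 1: "\<delta> a + \<delta> b = 0" using ab(2) by simp
    have "(\<Sum>w\<in>V. \<sigma> w * x w) = 0" by (rule span_sum_zero[OF \<sigma> triangle_V sx])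
    then have "(\<Sum>w\<in>V. \<delta> w * x w) = 0"
      using sum_\<phi>(2)[OF r(2)[OF X]] sum_\<phi>(2)[OF r(2)[OF Y]]
      by (simp add: \<delta>_def sum.distrib sum_subtractf left_diff_distrib distrib_right)
    moreover have "(\<Sum>w\<in>V. \<delta> w * x w) = (\<Sum>w\<in>{a, b}. \<delta> w * x w)"
      using ab off finite_verts by (intro sum.mono_neutral_right) auto
    ultimately have 2: "\<delta> a * x a + \<delta> b * x b = 0" using ab(2) by simp
    have b: "\<delta> b = - \<delta> a" using 1 by (simp add: eq_neg_iff_add_eq_0 add.commute)
    have "\<delta> a * (x a - x b) = 0" using 2 by (simp add: b algebra_simps)
    then have "\<delta> a = 0" using ab(5) by (simp add: three_mult_eq_0)
    then have V0: "\<delta> w = 0" if "w \<in> V" for w using off[of w] b that by auto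
    have zero: "\<delta> w = 0" for w
    proof (cases "w \<in> V")
      case False
      then have "w \<notin> r X" "w \<notin> r Y" using edge_subset r(2) X Y by blast+
      moreover have "ind T w = 0" if "T \<in> \<T>" for T
        using False triangle_V[OF that] by (auto simp: ind_def)
      ultimately show ?thesis by (simp add: \<delta>_def \<sigma>_def \<phi>_def)
    qed (rule V0)
    have "\<phi> (r X) w - \<phi> (r Y) w = (-1) * \<sigma> w" for w
      using zero[of w] by (simp add: \<delta>_def eq_neg_iff_add_eq_0)
    then have "(\<lambda>w. \<phi> (r X) w - \<phi> (r Y) w) \<in> tspan \<T>" using tspan_scale[OF \<sigma>, of "-1"] by simp
    then have "(r X, r Y) \<in> erel" using r(2) X Y by (simp add: erel_def)
    then have XY: "X = Y" using quotient_eqI[OF equiv_erel X Y r(1)[OF X] r(1)[OF Y]] by simp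
    then have "\<forall>w. (\<Sum>T\<in>\<T>. (c T - d T) * ind T w) = 0" using zero by (simp add: \<delta>_def \<sigma>_def)
    then have "c T - d T = 0" if "T \<in> \<T>" for T using triangles_independent[of "\<lambda>T. c T - d T"] that by simp
    then have "c = d" using c d by (intro PiE_ext) auto
    then show "X = Y \<and> c = d" using XY by simp
  qed
  moreover have "h z \<in> ?B" for z by (cases z) (simp add: h_def PiE_def)
  then have "h ` ?A \<subseteq> ?B" by (intro image_subsetI)
  moreover have "finite ?B" using finite_verts by (intro finite_PiE) auto
  ultimately have "card ?A \<le> card ?B" by (rule card_inj_on_le)
  moreover have "card ?A = card (E // erel) * 3 ^ card \<T>"
    using finite_T by (simp add: card_cartesian_product card_PiE)
  moreover have "card ?B = 3 ^ card ?D" using finite_verts by (simp add: card_PiE)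
  moreover have "card ?D = card V - 2" using ab finite_verts by (simp add: card_Diff_subset)
  ultimately show ?thesis by simp
qed

text \<open>From \<open>q \<ge> 1\<close> follows \<open>t \<le> n - 2\<close>. There is one class
  when \<open>t = n - 2\<close> and there are at most 3 when \<open>t = n - 3\<close>; both times
  \<open>2t + q \<le> 2n - 3\<close>.\<close>

lemma dense_triangles_bound:
  assumes "E \<noteq> {}" "card V \<le> card \<T> + 3"
  shows "card E + 3 \<le> 2 * card V"
proof -
  let ?q = "card (E // erel)"
  obtain e0 where "e0 \<in> E" using assms(1) by blast
  then obtain a b where ab: "a \<noteq> b" "a \<in> V" "b \<in> V" by (rule edge_pair)
  then have "card {a, b} \<le> card V" using finite_verts by (intro card_mono) auto
  then have V: "card V \<ge> 2" using ab(1) by simp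
  have "E // erel \<noteq> {}" using \<open>e0 \<in> E\<close> quotientI[of e0 E erel] by blast
  then have q: "?q \<ge> 1" using finite_quotient[OF finite_E, of erel] equiv_erel
    by (simp add: Suc_le_eq card_gt_0_iff equiv_type)
  have count: "?q * 3 ^ card \<T> \<le> 3 ^ (card V - 2)" by (rule class_count[OF assms(1)])
  have "(3 :: nat) ^ card \<T> \<le> ?q * 3 ^ card \<T>" using q by simp
  then have "(3 :: nat) ^ card \<T> \<le> 3 ^ (card V - 2)" using count by linarith
  then have t: "card \<T> \<le> card V - 2" by (simp add: power_increasing_iff)
  then consider "card V = card \<T> + 2" | "card V = card \<T> + 3" using assms(2) V by linarith
  then show ?thesis
  proof cases
    case 1
    then have "?q \<le> 1" using count by simp
    then show ?thesis using edge_card_classes 1 by simp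
  next
    case 2
    then have "?q * 3 ^ card \<T> \<le> 3 * 3 ^ card \<T>" using count by simp
    then have "?q \<le> 3" by simp
    then show ?thesis using edge_card_classes 2 by simp
  qed
qed

end

section \<open>Unique colourability: merged edges, Kempe chains and a long cycle\<close>

lemma of_nat_three_inj:
  assumes "i < 3" "j < 3" "(of_nat i :: 3) = of_nat j"
  shows "i = j"
proof -
  have "i \<in> {0, 1, 2}" "j \<in> {0, 1, 2}" using assms by auto
  then show ?thesis using assms(3) by auto
qed

context simple_graph
begin

lemma coloring_exists: "\<exists>k c. is_coloring k V E c"
proof -
  obtain f where f: "bij_betw f V {0..<card V}" using ex_bij_betw_finite_nat[OF finite_verts] by blast
  have "f v < card V" if "v \<in> V" for v using bij_betwE[OF f] that by auto
  moreover have "f u \<noteq> f v" if "u \<in> V" "v \<in> V" "{u, v} \<in> E" for u v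
  proof -
    have "u \<noteq> v" using edge_card[OF that(3)] by auto
    then show ?thesis using bij_betw_imp_inj_on[OF f] that by (auto dest: inj_onD)
  qed
  ultimately have "is_coloring (card V) V E f" unfolding is_coloring_def by blast
  then show ?thesis by blast
qed

lemma chromatic_coloring: "\<exists>c. is_coloring (chromatic_number V E) V E c"
  unfolding chromatic_number_def using coloring_exists by (rule LeastI_ex)

lemma chromatic_le: "is_coloring k V E c \<Longrightarrow> chromatic_number V E \<le> k"
  unfolding chromatic_number_def by (rule Least_le) blast

lemma is_coloring_mono: "is_coloring k V E c \<Longrightarrow> k \<le> l \<Longrightarrow> is_coloring l V E c"
  unfolding is_coloring_def by auto

lemma delete_edge: "simple_graph V (E - {e})"
  using finite_verts edge_subset edge_card by unfold_locales auto

text \<open>If every \<open>k\<close>-colouring of the graph without \<open>e\<close> separated the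
  ends of \<open>e\<close>, both graphs would have the same \<open>k\<close>-colourings, and
  deleting \<open>e\<close> would preserve unique colourability.\<close>

lemma coloring_merging_edge:
  assumes "edge_critical_uniquely_colorable k V E" "e \<in> E"
  shows "\<exists>c. is_coloring k V (E - {e}) c \<and> (\<forall>u\<in>e. \<forall>v\<in>e. c u = c v)"
proof (rule ccontr)
  assume neg: "\<not> ?thesis"
  interpret D: simple_graph V "E - {e}" by (rule delete_edge)
  have chi: "chromatic_number V E = k"
    and uniq: "\<And>c c'. is_coloring k V E c \<Longrightarrow> is_coloring k V E c' \<Longrightarrow> color_classes V c = color_classes V c'"
    and crit: "\<not> uniquely_colorable k V (E - {e})"
    using assms unfolding edge_critical_uniquely_colorable_def uniquely_colorable_def by blast+
  \<comment> \<open>Values \<open>l < k\<close> are included, because the chromatic number must also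
    be shown not to drop.\<close>
  have extend: "is_coloring l V E c" if c: "is_coloring l V (E - {e}) c" and l: "l \<le> k" for l c
  proof -
    have ck: "is_coloring k V (E - {e}) c" using D.is_coloring_mono[OF c l] .
    obtain a b where ab: "e = {a, b}" using edge_card[OF assms(2)] by (auto simp: card_2_iff)
    have "c a \<noteq> c b" using neg ck ab by auto
    then have "c u \<noteq> c v" if "{u, v} = e" for u v
      using that ab by (auto simp: doubleton_eq_iff)
    then show ?thesis using c unfolding is_coloring_def by blast
  qed
  have restrict: "is_coloring l V (E - {e}) c" if "is_coloring l V E c" for l c
    using that unfolding is_coloring_def by blast
  obtain c0 where "is_coloring k V E c0" using chromatic_coloring chi by blast
  then have le: "chromatic_number V (E - {e}) \<le> k" using restrict D.chromatic_le by blast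
  obtain c1 where "is_coloring (chromatic_number V (E - {e})) V (E - {e}) c1"
    using D.chromatic_coloring by blast
  then have "k \<le> chromatic_number V (E - {e})" using extend[OF _ le] chromatic_le chi by blast
  then have "chromatic_number V (E - {e}) = k" using le by simp
  then have "uniquely_colorable k V (E - {e})"
    using uniq extend unfolding uniquely_colorable_def by blast
  then show False using crit by simp
qed

text \<open>The set \<open>S\<close> is a union of components of the subgraph on the colours
  \<open>i\<close> and \<open>j\<close>; exchange these colours on \<open>S\<close>. If
  \<open>v\<close> were outside, the new colouring would separate \<open>u\<close> from
  \<open>v\<close>, which share a class of the old one.\<close>

lemma Kempe_chain:
  assumes uniq: "uniquely_colorable k V E" and c: "is_coloring k V E c"
    and ij: "i < k" "j < k" "i \<noteq> j" and S: "S \<subseteq> V" "\<And>s. s \<in> S \<Longrightarrow> c s = i \<or> c s = j"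
    and closed: "\<And>s w. s \<in> S \<Longrightarrow> {s, w} \<in> E \<Longrightarrow> c w = i \<or> c w = j \<Longrightarrow> w \<in> S"
    and u: "u \<in> S" "c u = i" and v: "v \<in> V" "c v = i"
  shows "v \<in> S"
proof (rule ccontr)
  assume vS: "v \<notin> S"
  define c' where "c' w = (if w \<in> S then (if c w = i then j else i) else c w)" for w
  have "c' s \<noteq> c' w" if sw: "s \<in> V" "w \<in> V" "{s, w} \<in> E" for s w
  proof -
    have ne: "c s \<noteq> c w" using c sw unfolding is_coloring_def by blast
    have "{w, s} \<in> E" using sw(3) by (simp add: insert_commute)
    then show ?thesis
      using ne S(2)[of s] S(2)[of w] closed[of s w] closed[of w s] sw(3) ij(3) by (auto simp: c'_def)
  qed
  moreover have "c' w < k" if "w \<in> V" for w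
    using that c ij unfolding c'_def is_coloring_def by auto
  ultimately have "is_coloring k V E c'" unfolding is_coloring_def by blast
  then have eq: "color_classes V c' = color_classes V c"
    using uniq c unfolding uniquely_colorable_def by blast
  have uV: "u \<in> V" using u S by blast
  have "{w \<in> V. c w = i} \<in> color_classes V c" unfolding color_classes_def using u(2) uV by blast
  then have "{w \<in> V. c w = i} \<in> color_classes V c'" using eq by simp
  then obtain l where l: "{w \<in> V. c w = i} = {w \<in> V. c' w = l}"
    unfolding color_classes_def by blast
  have "u \<in> {w \<in> V. c w = i}" "v \<in> {w \<in> V. c w = i}" using u v uV by simp_all
  then have "c' u = c' v" unfolding l by simp
  then show False using u v vS ij(3) by (simp add: c'_def)
qed

end

text \<open>Some colour \<open>i\<close> occurs twice. A Kempe chain in colours \<open>i\<close> and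
  \<open>j\<close> yields a vertex \<open>b\<close> of colour \<open>j\<close> with two neighbours
  \<open>u\<close> and \<open>u'\<close> of colour \<open>i\<close>. These are also joined by a path
  in colours \<open>i\<close> and \<open>k\<close>, which avoids \<open>b\<close> and has at least 2
  edges, its ends having the same colour.\<close>

lemma uniquely_three_colorable_long_cycle:
  assumes G: "simple_graph V E" and uniq: "uniquely_colorable 3 V E" and "card V \<ge> 4"
  obtains C where "C \<subseteq> E" "cycle C" "card C \<ge> 4"
proof -
  interpret simple_graph V E by (rule G)
  have "chromatic_number V E = 3" using uniq by (simp add: uniquely_colorable_def)
  then obtain c where c: "is_coloring 3 V E c" using chromatic_coloring by auto
  have proper: "c u \<noteq> c v" if "{u, v} \<in> E" for u v
    using c that edge_subset[OF that] unfolding is_coloring_def by blast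
  have lt: "c v < 3" if "v \<in> V" for v using c that unfolding is_coloring_def by blast
  have "\<not> inj_on c V"
  proof
    assume "inj_on c V"
    moreover have "c ` V \<subseteq> {..<3}" using lt by blast
    ultimately have "card V \<le> card {..<3::nat}" by (intro card_inj_on_le[of c]) auto
    then show False using assms(3) by simp
  qed
  then obtain u v where uv: "u \<in> V" "v \<in> V" "u \<noteq> v" "c u = c v" unfolding inj_on_def by blast
  define i where "i = c u"
  have i3: "i < 3" using lt[OF uv(1)] i_def by simp
  then consider "i = 0" | "i = 1" | "i = 2" by linarith
  then have "\<exists>j k. j < 3 \<and> k < 3 \<and> i \<noteq> j \<and> i \<noteq> k \<and> j \<noteq> k"
  proof cases
    case 1
    then show ?thesis by (intro exI[of _ 1] exI[of _ 2]) simp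
  next
    case 2
    then show ?thesis by (intro exI[of _ 0] exI[of _ 2]) simp
  next
    case 3
    then show ?thesis by (intro exI[of _ 0] exI[of _ 1]) simp
  qed
  then obtain j k where jk: "j < 3" "k < 3" "i \<noteq> j" "i \<noteq> k" "j \<noteq> k" by blast
  have "\<exists>b u'. {u, b} \<in> E \<and> {b, u'} \<in> E \<and> c b = j \<and> c u' = i \<and> u' \<noteq> u"
  proof (rule ccontr)
    assume neg: "\<not> ?thesis"
    \<comment> \<open>Under the negated claim this star is closed as a Kempe chain, yet
      \<open>u\<close> is its only vertex of colour \<open>i\<close>, so it misses
      \<open>v\<close>.\<close>
    define S where "S = insert u {b \<in> V. {u, b} \<in> E \<and> c b = j}"
    have "v \<in> S"
    proof (rule Kempe_chain[OF uniq c i3 jk(1,3)])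
      show "S \<subseteq> V" using uv(1) by (auto simp: S_def)
      show "c s = i \<or> c s = j" if "s \<in> S" for s using that i_def by (auto simp: S_def)
      show "w \<in> S" if s: "s \<in> S" "{s, w} \<in> E" "c w = i \<or> c w = j" for s w
      proof (cases "s = u")
        case True
        then have "c w = j" using proper[OF s(2)] s(3) i_def by auto
        moreover have "w \<in> V" using edge_subset[OF s(2)] by simp
        ultimately show ?thesis using s(2) True by (simp add: S_def)
      next
        case False
        then have sb: "{u, s} \<in> E" "c s = j" using s(1) by (auto simp: S_def)
        then have "c w = i" using proper[OF s(2)] s(3) by auto
        then have "w = u" using neg sb s(2) by blast
        then show ?thesis by (simp add: S_def)
      qed
      show "u \<in> S" by (simp add: S_def)
    qed (use uv i_def in simp_all)
    then show False using uv jk i_def by (auto simp: S_def)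
  qed
  then obtain b u' where b: "{u, b} \<in> E" "{b, u'} \<in> E" "c b = j" and u': "c u' = i" "u' \<noteq> u"
    by blast
  define F where "F = {e \<in> E. \<forall>y\<in>e. c y = i \<or> c y = k}"
  define S where "S = reach F u"
  have SF: "S \<subseteq> insert u (\<Union>F)" unfolding S_def by (rule reach_subset)
  have FV: "\<Union>F \<subseteq> V" using edge_subset unfolding F_def by blast
  have Fc: "c y = i \<or> c y = k" if "y \<in> \<Union>F" for y using that unfolding F_def by blast
  have Sc: "c s = i \<or> c s = k" if "s \<in> S" for s
  proof (cases "s = u")
    case False
    then have "s \<in> \<Union>F" using that SF by blast
    then show ?thesis by (rule Fc)
  qed (simp add: i_def)
  have u'V: "u' \<in> V" using edge_subset[OF b(2)] by simp
  have "u' \<in> S"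
  proof (rule Kempe_chain[OF uniq c i3 jk(2,4) _ Sc])
    show "S \<subseteq> V" using SF FV uv(1) by blast
    show "w \<in> S" if s: "s \<in> S" "{s, w} \<in> E" "c w = i \<or> c w = k" for s w
    proof -
      have "{s, w} \<in> F" using Sc[OF s(1)] s(2,3) by (simp add: F_def)
      moreover have "s \<noteq> w" using proper[OF s(2)] by auto
      ultimately show ?thesis using s(1) reach_edge[of s F u w] unfolding S_def by simp
    qed
    show "u \<in> S" unfolding S_def by (rule reach_self)
  qed (use u' u'V i_def in simp_all)
  then obtain Q where Q: "Q \<subseteq> F" "edge_path Q u u'" using u'(2) unfolding S_def reach_def by blast
  define P where "P = {{u, b}, {b, u'}}"
  have ne: "u \<noteq> b" "b \<noteq> u'" using b(3) u'(1) i_def jk(3) by auto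
  have "edge_path {{b, u'}} b u'" using ne(2) by (rule edge_path.edge)
  moreover have "u \<notin> \<Union>{{b, u'}}" using ne u'(2) by simp
  ultimately have P: "edge_path P u u'" unfolding P_def by (rule edge_path.step)
  have QF: "\<Union>Q \<subseteq> \<Union>F" using Q(1) by blast
  have bQ: "b \<notin> \<Union>Q"
  proof
    assume "b \<in> \<Union>Q"
    then have "b \<in> \<Union>F" using QF by (rule subsetD[rotated])
    from Fc[OF this] show False using b(3) jk by simp
  qed
  have UP: "\<Union>P = {u, b, u'}" by (auto simp: P_def)
  have "\<Union>P \<inter> \<Union>Q = {u, u'}" unfolding UP using bQ edge_path_ends(2,3)[OF Q(2)] by blast
  moreover have disj: "P \<inter> Q = {}" using bQ unfolding P_def by blast
  ultimately have "cycle (P \<union> Q)" using P Q(2) unfolding cycle_def cycle_at_def by blast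
  moreover have "P \<union> Q \<subseteq> E" using b(1,2) Q(1) unfolding P_def F_def by blast
  moreover have "card (P \<union> Q) \<ge> 4"
  proof -
    have fin: "finite P" "finite Q" using edge_path_finite(1)[OF P] edge_path_finite(1)[OF Q(2)] .
    have "card Q \<noteq> 1"
    proof
      assume "card Q = 1"
      then have "{u, u'} \<in> E" using edge_path_card_1[OF Q(2)] Q(1) unfolding F_def by blast
      then show False using proper[of u u'] u'(1) i_def by simp
    qed
    moreover have "card Q \<noteq> 0" using fin(2) edge_path_nonempty[OF Q(2)] by simp
    ultimately have "card Q \<ge> 2" by linarith
    moreover have "card P = 2" using ne u'(2) by (simp add: P_def doubleton_eq_iff)
    ultimately show ?thesis using card_Un_disjoint[OF fin disj] by simp
  qed
  ultimately show thesis using that by blast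
qed

theorem theorem4p6:
  fixes V :: "'a set" and E :: "'a set set"
  assumes "simple_graph V E"
    and "planar V E"
    and "edge_critical_uniquely_colorable 3 V E"
    and "card V \<ge> 6"
  shows "real (card E) \<le> 5 / 2 * real (card V) - 6"
proof -
  interpret simple_graph V E by (rule assms(1))
  have uniq: "uniquely_colorable 3 V E"
    using assms(3) by (simp add: edge_critical_uniquely_colorable_def)
  have "card V \<ge> 4" using assms(4) by simp
  then obtain C where C: "C \<subseteq> E" "cycle C" "card C \<ge> 4"
    by (rule uniquely_three_colorable_long_cycle[OF assms(1) uniq])
  have planar_bound: "2 * card E + 8 \<le> 4 * card V + card (triangles E)"
    by (rule planar_edge_bound[OF assms(1,2) C])
  have "chromatic_number V E = 3" using uniq by (simp add: uniquely_colorable_def)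
  then obtain c where c: "is_coloring 3 V E c" using chromatic_coloring by auto
  have neq: "(of_nat (d u) :: 3) \<noteq> of_nat (d v)"
    if d: "is_coloring 3 V F d" and uv: "{u, v} \<in> F" and F: "F \<subseteq> E" for F d u v
  proof -
    have "{u, v} \<in> E" using uv F by (rule subsetD[rotated])
    from edge_subset[OF this] have V: "u \<in> V" "v \<in> V" by simp_all
    then have "d u < 3" "d v < 3" "d u \<noteq> d v" using d uv unfolding is_coloring_def by blast+
    then show ?thesis using of_nat_three_inj[of "d u" "d v"] by auto
  qed
  interpret irredundant_graph V E "\<lambda>v. of_nat (c v)"
  proof
    show "of_nat (c u) \<noteq> (of_nat (c v) :: 3)" if "{u, v} \<in> E" for u v
      by (rule neq[OF c that subset_refl])
    show "\<exists>z :: 'a \<Rightarrow> 3. (\<forall>u v. {u, v} \<in> E - {e} \<longrightarrow> z u \<noteq> z v) \<and> (\<forall>u\<in>e. \<forall>v\<in>e. z u = z v)"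
      if e: "e \<in> E" for e
    proof -
      obtain d where d: "is_coloring 3 V (E - {e}) d" "\<forall>u\<in>e. \<forall>v\<in>e. d u = d v"
        using coloring_merging_edge[OF assms(3) e] by (elim exE conjE)
      have "\<forall>u v. {u, v} \<in> E - {e} \<longrightarrow> (of_nat (d u) :: 3) \<noteq> of_nat (d v)"
        using neq[OF d(1) _ Diff_subset] by blast
      moreover have "\<forall>u\<in>e. \<forall>v\<in>e. (of_nat (d u) :: 3) = of_nat (d v)" using d(2) by metis
      ultimately show ?thesis by (intro exI[of _ "\<lambda>v. of_nat (d v)"] conjI)
    qed
  qed
  have "E \<noteq> {}" using C by auto
  have "2 * card E + 12 \<le> 5 * card V"
  proof (cases "card V \<le> card (triangles E) + 3")
    case True
    \<comment> \<open>The bound \<open>|E| \<le> 2n - 3\<close> is strong enough precisely from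
      \<open>n = 6\<close> on.\<close>
    then show ?thesis using dense_triangles_bound[OF \<open>E \<noteq> {}\<close>] assms(4) by linarith
  next
    case False
    \<comment> \<open>Here \<open>t \<le> n - 4\<close>, so \<open>2|E| + 8 \<le> 5n - 4\<close>,
      which is the claim without any slack.\<close>
    then show ?thesis using planar_bound by linarith
  qed
  then have "real (2 * card E + 12) \<le> real (5 * card V)" by (rule of_nat_mono)
  then show ?thesis by simp
qed

end
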